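(* Let $\mathcal{A}$ be an essentially small category and put $\mathcal{B}=\mathbb{B}(\mathcal{A})$. Then: (a) $\mathcal{B}$ is a $\mathrm{B}_1$-category if and only if $\mathcal{A}$ is an $\mathrm{A}_1$-category. (b) $\mathcal{B}$ is a $\mathrm{B}$-category if and only if $\mathcal{A}$ is an $\mathrm{A}$-category. (c) $\mathcal{B}$ is a non-degenerate $\mathrm{B}$-category if and only if $\mathcal{A}$ is an $\mathrm{A}$-category that has an initial object and satisfies the amalgamation property.
   Context: The category $\mathbb{B}(\mathcal{A})$: objects are finite (possibly empty) sequences $(X_1,\dots,X_n)$ of objects of $\mathcal{A}$; a morphism $(X_1,\dots,X_n)\to(Y_1,\dots,Y_m)$ is a function $a\colon\{1,\dots,n\}\to\{1,\dots,m\}$ together with, for each $i$, a morphism $X_i\to Y_{a(i)}$ in $\mathcal{A}^{\mathrm{op}}$; composition is the obvious one. In a category with finite co-products, write $\mathbf{0}$ for the initial object; an object is empty if it is isomorphic to $\mathbf{0}$. An object $X$ is an atom (atomic) if it is non-empty and, whenever $X \cong Y \amalg Z$, either $Y$ or $Z$ is empty. A $\mathrm{B}_1$-category is an essentially small category $\mathcal{B}$ such that: it has finite co-products; every object is isomorphic to a finite co-product of atoms; for objects $X,Y,Z$ with $X$ atomic, the natural map $\mathrm{Hom}(X,Y)\amalg \mathrm{Hom}(X,Z)\to \mathrm{Hom}(X,Y\amalg Z)$ is a bijection; and it has fiber products and a final object $\mathbf{1}$. A $\mathrm{B}$-category is a $\mathrm{B}_1$-category in which any monomorphism of atoms is an isomorphism.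 A $\mathrm{B}$-category is non-degenerate if $\mathbf{1}$ is atomic and, for all maps of atoms $X\to Z$ and $Y\to Z$, the fiber product $X\times_Z Y$ is non-empty. An initial set of a category is a set $S$ of objects such that for every object $X$ there is a unique $I\in S$ with $\mathrm{Hom}(I,X)\neq\varnothing$, and for this $I$ the set $\mathrm{Hom}(I,X)$ has exactly one element. A pre-amalgamation in $\mathcal{A}$ is a pair of morphisms $(b\colon A\to B,\ c\colon A\to C)$; $\mathrm{Amalg}(b,c)$ is the category of pairs $(b'\colon B\to D,\ c'\colon C\to D)$ with $b'b=c'c$, with the obvious morphisms; an amalgamation set for $(b,c)$ is an initial set of $\mathrm{Amalg}(b,c)$. $\mathcal{A}$ satisfies the amalgamation property if $\mathrm{Amalg}(b,c)$ is non-empty for every pre-amalgamation $(b,c)$. An $\mathrm{A}_1$-category is an essentially small category that has a finite initial set and in which every pre-amalgamation has a finite amalgamation set. An $\mathrm{A}$-category is an $\mathrm{A}_1$-category in which every epimorphism is an isomorphism. *)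

theory Defs
  imports Main
begin

section \<open>Categories\<close>

text \<open>
  The objects of a category form a set over a type \<open>'o\<close> and its arrows a set over a type \<open>'m\<close>.
  A HOL type is a set in the usual semantics, so such a category is a small one: essential
  smallness of a category needs no further predicate here, and every essentially small category
  is represented, up to equivalence, by a small one. The value of \<open>Comp\<close> on non-composable
  arrows is irrelevant.
\<close>

record ('o, 'm) cat =
  Obj :: "'o set"
  Arr :: "'m set"
  Dom :: "'m \<Rightarrow> 'o"
  Cod :: "'m \<Rightarrow> 'o"
  Ide :: "'o \<Rightarrow> 'm"
  Comp :: "'m \<Rightarrow> 'm \<Rightarrow> 'm"  (infixl "\<cdot>\<index>" 70)

definition hom :: "('o, 'm) cat \<Rightarrow> 'o \<Rightarrow> 'o \<Rightarrow> 'm set" where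
  "hom C X Y = {f \<in> Arr C. Dom C f = X \<and> Cod C f = Y}"

locale category =
  fixes C :: "('o, 'm) cat" (structure)
  assumes Dom_closed: "f \<in> Arr C \<Longrightarrow> Dom C f \<in> Obj C"
    and Cod_closed: "f \<in> Arr C \<Longrightarrow> Cod C f \<in> Obj C"
    and Ide_hom: "X \<in> Obj C \<Longrightarrow> Ide C X \<in> hom C X X"
    and Comp_hom: "\<lbrakk>f \<in> hom C X Y; g \<in> hom C Y Z\<rbrakk> \<Longrightarrow> g \<cdot> f \<in> hom C X Z"
    and Comp_Ide: "f \<in> hom C X Y \<Longrightarrow> f \<cdot> Ide C X = f"
    and Ide_Comp: "f \<in> hom C X Y \<Longrightarrow> Ide C Y \<cdot> f = f"
    and Comp_assoc: "\<lbrakk>f \<in> hom C W X; g \<in> hom C X Y; h \<in> hom C Y Z\<rbrakk>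
                       \<Longrightarrow> (h \<cdot> g) \<cdot> f = h \<cdot> (g \<cdot> f)"

definition op_cat :: "('o, 'm) cat \<Rightarrow> ('o, 'm) cat" where
  "op_cat C = \<lparr>Obj = Obj C, Arr = Arr C, Dom = Cod C, Cod = Dom C, Ide = Ide C,
               Comp = (\<lambda>g f. f \<cdot>\<^bsub>C\<^esub> g)\<rparr>"

definition iso_arr :: "('o, 'm) cat \<Rightarrow> 'm \<Rightarrow> bool" where
  "iso_arr C f \<longleftrightarrow> f \<in> Arr C \<and>
     (\<exists>g \<in> hom C (Cod C f) (Dom C f).
        g \<cdot>\<^bsub>C\<^esub> f = Ide C (Dom C f) \<and> f \<cdot>\<^bsub>C\<^esub> g = Ide C (Cod C f))"

definition isomorphic :: "('o, 'm) cat \<Rightarrow> 'o \<Rightarrow> 'o \<Rightarrow> bool" where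
  "isomorphic C X Y \<longleftrightarrow> (\<exists>f \<in> hom C X Y. iso_arr C f)"

definition mono_arr :: "('o, 'm) cat \<Rightarrow> 'm \<Rightarrow> bool" where
  "mono_arr C f \<longleftrightarrow> f \<in> Arr C \<and>
     (\<forall>W \<in> Obj C. \<forall>g \<in> hom C W (Dom C f). \<forall>h \<in> hom C W (Dom C f).
        f \<cdot>\<^bsub>C\<^esub> g = f \<cdot>\<^bsub>C\<^esub> h \<longrightarrow> g = h)"

definition epi_arr :: "('o, 'm) cat \<Rightarrow> 'm \<Rightarrow> bool" where
  "epi_arr C f \<longleftrightarrow> f \<in> Arr C \<and>
     (\<forall>W \<in> Obj C. \<forall>g \<in> hom C (Cod C f) W. \<forall>h \<in> hom C (Cod C f) W.
        g \<cdot>\<^bsub>C\<^esub> f = h \<cdot>\<^bsub>C\<^esub> f \<longrightarrow> g = h)"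

definition initial_obj :: "('o, 'm) cat \<Rightarrow> 'o \<Rightarrow> bool" where
  "initial_obj C I \<longleftrightarrow> I \<in> Obj C \<and> (\<forall>X \<in> Obj C. \<exists>!f. f \<in> hom C I X)"

definition final_obj :: "('o, 'm) cat \<Rightarrow> 'o \<Rightarrow> bool" where
  "final_obj C T \<longleftrightarrow> T \<in> Obj C \<and> (\<forall>X \<in> Obj C. \<exists>!f. f \<in> hom C X T)"

text \<open>
  \<open>P\<close> with the injections \<open>js\<close> is a co-product of the finite family \<open>Xs\<close>. The empty family is
  allowed; its co-products are the initial objects.
\<close>

definition coproduct :: "('o, 'm) cat \<Rightarrow> 'o list \<Rightarrow> 'o \<Rightarrow> 'm list \<Rightarrow> bool" where
  "coproduct C Xs P js \<longleftrightarrow>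
     set Xs \<subseteq> Obj C \<and> P \<in> Obj C \<and> list_all2 (\<lambda>X j. j \<in> hom C X P) Xs js \<and>
     (\<forall>Q \<in> Obj C. \<forall>ks. list_all2 (\<lambda>X k. k \<in> hom C X Q) Xs ks \<longrightarrow>
        (\<exists>!h. h \<in> hom C P Q \<and> map (\<lambda>j. h \<cdot>\<^bsub>C\<^esub> j) js = ks))"

definition has_finite_coproducts :: "('o, 'm) cat \<Rightarrow> bool" where
  "has_finite_coproducts C \<longleftrightarrow> (\<forall>Xs. set Xs \<subseteq> Obj C \<longrightarrow> (\<exists>P js. coproduct C Xs P js))"

definition fiber_product ::
    "('o, 'm) cat \<Rightarrow> 'm \<Rightarrow> 'm \<Rightarrow> 'o \<Rightarrow> 'm \<Rightarrow> 'm \<Rightarrow> bool" where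
  "fiber_product C f g P p q \<longleftrightarrow>
     f \<in> Arr C \<and> g \<in> Arr C \<and> Cod C f = Cod C g \<and>
     p \<in> hom C P (Dom C f) \<and> q \<in> hom C P (Dom C g) \<and> f \<cdot>\<^bsub>C\<^esub> p = g \<cdot>\<^bsub>C\<^esub> q \<and>
     (\<forall>W \<in> Obj C. \<forall>u \<in> hom C W (Dom C f). \<forall>v \<in> hom C W (Dom C g).
        f \<cdot>\<^bsub>C\<^esub> u = g \<cdot>\<^bsub>C\<^esub> v \<longrightarrow>
        (\<exists>!h. h \<in> hom C W P \<and> p \<cdot>\<^bsub>C\<^esub> h = u \<and> q \<cdot>\<^bsub>C\<^esub> h = v))"

definition has_fiber_products :: "('o, 'm) cat \<Rightarrow> bool" where
  "has_fiber_products C \<longleftrightarrow>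
     (\<forall>f \<in> Arr C. \<forall>g \<in> Arr C. Cod C f = Cod C g \<longrightarrow> (\<exists>P p q. fiber_product C f g P p q))"


section \<open>\<open>B\<close>-categories\<close>

definition empty_obj :: "('o, 'm) cat \<Rightarrow> 'o \<Rightarrow> bool" where
  "empty_obj C X \<longleftrightarrow> (\<exists>I. initial_obj C I \<and> isomorphic C X I)"

definition atom :: "('o, 'm) cat \<Rightarrow> 'o \<Rightarrow> bool" where
  "atom C X \<longleftrightarrow> X \<in> Obj C \<and> \<not> empty_obj C X \<and>
     (\<forall>Y Z P js. coproduct C [Y, Z] P js \<and> isomorphic C X P \<longrightarrow>
        empty_obj C Y \<or> empty_obj C Z)"

definition B1_category :: "('o, 'm) cat \<Rightarrow> bool" where
  "B1_category C \<longleftrightarrow>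
     category C \<and>
     has_finite_coproducts C \<and>
     (\<forall>X \<in> Obj C. \<exists>Xs P js. (\<forall>Y \<in> set Xs. atom C Y) \<and> coproduct C Xs P js \<and> isomorphic C X P) \<and>
     (\<forall>X Y Z P i j. atom C X \<and> coproduct C [Y, Z] P [i, j] \<longrightarrow>
        bij_betw (case_sum (\<lambda>f. i \<cdot>\<^bsub>C\<^esub> f) (\<lambda>g. j \<cdot>\<^bsub>C\<^esub> g))
          (hom C X Y <+> hom C X Z) (hom C X P)) \<and>
     has_fiber_products C \<and>
     (\<exists>T. final_obj C T)"

definition B_category :: "('o, 'm) cat \<Rightarrow> bool" where
  "B_category C \<longleftrightarrow> B1_category C \<and>
     (\<forall>f. mono_arr C f \<and> atom C (Dom C f) \<and> atom C (Cod C f) \<longrightarrow> iso_arr C f)"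

definition nondegenerate :: "('o, 'm) cat \<Rightarrow> bool" where
  "nondegenerate C \<longleftrightarrow>
     (\<forall>T. final_obj C T \<longrightarrow> atom C T) \<and>
     (\<forall>f g P p q. atom C (Dom C f) \<and> atom C (Dom C g) \<and> atom C (Cod C f) \<and>
        fiber_product C f g P p q \<longrightarrow> \<not> empty_obj C P)"


section \<open>\<open>A\<close>-categories\<close>

definition initial_set :: "('o, 'm) cat \<Rightarrow> 'o set \<Rightarrow> bool" where
  "initial_set C S \<longleftrightarrow> S \<subseteq> Obj C \<and>
     (\<forall>X \<in> Obj C. (\<exists>!I. I \<in> S \<and> hom C I X \<noteq> {}) \<and>
        (\<forall>I \<in> S. hom C I X \<noteq> {} \<longrightarrow> (\<exists>!f. f \<in> hom C I X)))"

definition preamalgamation :: "('o, 'm) cat \<Rightarrow> 'm \<Rightarrow> 'm \<Rightarrow> bool" where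
  "preamalgamation C b c \<longleftrightarrow> b \<in> Arr C \<and> c \<in> Arr C \<and> Dom C b = Dom C c"

text \<open>
  An object of \<open>Amalg C b c\<close> is a pair \<open>(b', c')\<close>; the vertex \<open>D\<close> of the square is the common
  codomain. An arrow carries its source and target pair: it is a triple
  \<open>((b', c'), h, (b'', c''))\<close> with \<open>h\<close> an arrow under both \<open>B\<close> and \<open>C\<close>.
\<close>

definition Amalg ::
    "('o, 'm) cat \<Rightarrow> 'm \<Rightarrow> 'm \<Rightarrow> ('m \<times> 'm, ('m \<times> 'm) \<times> 'm \<times> ('m \<times> 'm)) cat" where
  "Amalg C b c =
    (let Sq = {(b', c'). \<exists>D \<in> Obj C. b' \<in> hom C (Cod C b) D \<and> c' \<in> hom C (Cod C c) D \<and>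
                 b' \<cdot>\<^bsub>C\<^esub> b = c' \<cdot>\<^bsub>C\<^esub> c}
     in \<lparr>Obj = Sq,
         Arr = {((b', c'), h, (b'', c'')). (b', c') \<in> Sq \<and> (b'', c'') \<in> Sq \<and>
                 h \<in> hom C (Cod C b') (Cod C b'') \<and>
                 h \<cdot>\<^bsub>C\<^esub> b' = b'' \<and> h \<cdot>\<^bsub>C\<^esub> c' = c''},
         Dom = fst,
         Cod = snd \<circ> snd,
         Ide = (\<lambda>s. (s, Ide C (Cod C (fst s)), s)),
         Comp = (\<lambda>(_, k, t) (s, h, _). (s, k \<cdot>\<^bsub>C\<^esub> h, t))\<rparr>)"

definition amalgamation_set :: "('o, 'm) cat \<Rightarrow> 'm \<Rightarrow> 'm \<Rightarrow> ('m \<times> 'm) set \<Rightarrow> bool" where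
  "amalgamation_set C b c S \<longleftrightarrow> initial_set (Amalg C b c) S"

definition amalgamation_property :: "('o, 'm) cat \<Rightarrow> bool" where
  "amalgamation_property C \<longleftrightarrow>
     (\<forall>b c. preamalgamation C b c \<longrightarrow> Obj (Amalg C b c) \<noteq> {})"

definition A1_category :: "('o, 'm) cat \<Rightarrow> bool" where
  "A1_category C \<longleftrightarrow>
     category C \<and>
     (\<exists>S. finite S \<and> initial_set C S) \<and>
     (\<forall>b c. preamalgamation C b c \<longrightarrow> (\<exists>S. finite S \<and> amalgamation_set C b c S))"

definition A_category :: "('o, 'm) cat \<Rightarrow> bool" where
  "A_category C \<longleftrightarrow> A1_category C \<and> (\<forall>f. epi_arr C f \<longrightarrow> iso_arr C f)"


section \<open>The category \<open>\<bbbB>(A)\<close>\<close>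

text \<open>
  An arrow \<open>FamArr Xs Ys a fs\<close> stores the function \<open>a\<close> and the family of components as lists
  indexed like \<open>Xs\<close>, so that equal arrows are equal as values; indices start at \<open>0\<close>.
\<close>

datatype ('o, 'm) fam_arr =
  FamArr (fam_dom: "'o list") (fam_cod: "'o list") (fam_idx: "nat list") (fam_mor: "'m list")

definition BB :: "('o, 'm) cat \<Rightarrow> ('o list, ('o, 'm) fam_arr) cat" where
  "BB A =
    \<lparr>Obj = {Xs. set Xs \<subseteq> Obj A},
     Arr = {FamArr Xs Ys a fs | Xs Ys a fs.
              set Xs \<subseteq> Obj A \<and> set Ys \<subseteq> Obj A \<and>
              length a = length Xs \<and> length fs = length Xs \<and>
              (\<forall>i < length Xs. a ! i < length Ys \<and>
                 fs ! i \<in> hom (op_cat A) (Xs ! i) (Ys ! (a ! i)))},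
     Dom = fam_dom,
     Cod = fam_cod,
     Ide = (\<lambda>Xs. FamArr Xs Xs [0..<length Xs] (map (Ide (op_cat A)) Xs)),
     Comp = (\<lambda>G F. FamArr (fam_dom F) (fam_cod G)
              (map (\<lambda>i. fam_idx G ! (fam_idx F ! i)) [0..<length (fam_dom F)])
              (map (\<lambda>i. (fam_mor G ! (fam_idx F ! i)) \<cdot>\<^bsub>op_cat A\<^esub> (fam_mor F ! i))
                   [0..<length (fam_dom F)]))\<rparr>"

end

theory Submission
  imports Defs
begin

text \<open>
  An arrow out of a family is the same as a family of arrows out of its members, and an arrow from a
  one-element family \<open>[x]\<close> to \<open>P\<close> is an index \<open>k\<close> with an arrow \<open>P ! k \<rightarrow> x\<close> of \<open>A\<close>. Hence concatenation
  is the co-product, the atoms are the one-element families, and \<open>B\<^sub>1\<close> reduces to the existence of a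
  final object and of fiber products. Tested on one-element families, these say that \<open>A\<close> has a finite
  initial set and that the pairs of components of the two projections form a finite amalgamation set.
  Monomorphisms and isomorphisms of atoms are the epimorphisms and isomorphisms of \<open>A\<close>. An atomic
  final object is an initial object of \<open>A\<close>, and a fiber product of atoms is non-empty exactly if the
  corresponding pre-amalgamation can be completed to a square.
\<close>

section \<open>Categories\<close>

lemma hom_Cod: "f \<in> hom C X Y \<Longrightarrow> Cod C f = Y"
  by (simp add: hom_def)

section \<open>Uniqueness and iteration of co-products\<close>

context category
begin

lemma isomorphic_refl: "X \<in> Obj C \<Longrightarrow> isomorphic C X X"
  using Ide_hom[of X] Comp_Ide[OF Ide_hom, of X]
  by (auto simp: isomorphic_def iso_arr_def hom_def)

text \<open>The two mediating arrows compose to endomorphisms that fix every injection, so the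
  universal property forces both composites to be identities. The conclusion also records
  compatibility with the injections, because the bijection of Hom-sets in the definition of a
  \<open>B1_category\<close> refers to particular injections.\<close>

lemma coproduct_unique:
  assumes P: "coproduct C Xs P js" and Q: "coproduct C Xs Q ks"
  shows "\<exists>h \<in> hom C P Q. iso_arr C h \<and> map (\<lambda>j. h \<cdot> j) js = ks"
proof -
  have js: "list_all2 (\<lambda>X j. j \<in> hom C X P) Xs js" and ks: "list_all2 (\<lambda>X k. k \<in> hom C X Q) Xs ks"
    and PO: "P \<in> Obj C" and QO: "Q \<in> Obj C"
    using P Q by (auto simp: coproduct_def)
  obtain h where h: "h \<in> hom C P Q" "map (\<lambda>j. h \<cdot> j) js = ks"
    using P ks QO unfolding coproduct_def by meson
  obtain g where g: "g \<in> hom C Q P" "map (\<lambda>j. g \<cdot> j) ks = js"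
    using Q js PO unfolding coproduct_def by meson
  have js_hom: "\<exists>X. j \<in> hom C X P" if "j \<in> set js" for j
    using js that by (auto simp: list_all2_conv_all_nth in_set_conv_nth)
  have ks_hom: "\<exists>X. k \<in> hom C X Q" if "k \<in> set ks" for k
    using ks that by (auto simp: list_all2_conv_all_nth in_set_conv_nth)
  have "map (\<lambda>j. (g \<cdot> h) \<cdot> j) js = map (\<lambda>k. g \<cdot> k) (map (\<lambda>j. h \<cdot> j) js)"
    using js_hom h(1) g(1) Comp_assoc by (fastforce)
  hence "map (\<lambda>j. (g \<cdot> h) \<cdot> j) js = js" using h(2) g(2) by simp
  moreover have "map (\<lambda>j. Ide C P \<cdot> j) js = js"
    using js_hom Ide_Comp by (fastforce intro: map_idI)
  ultimately have gh: "g \<cdot> h = Ide C P"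
    using P js PO Comp_hom[OF h(1) g(1)] Ide_hom[OF PO] unfolding coproduct_def by blast
  have "map (\<lambda>j. (h \<cdot> g) \<cdot> j) ks = map (\<lambda>k. h \<cdot> k) (map (\<lambda>j. g \<cdot> j) ks)"
    using ks_hom h(1) g(1) Comp_assoc by (fastforce)
  hence "map (\<lambda>j. (h \<cdot> g) \<cdot> j) ks = ks" using h(2) g(2) by simp
  moreover have "map (\<lambda>j. Ide C Q \<cdot> j) ks = ks"
    using ks_hom Ide_Comp by (fastforce intro: map_idI)
  ultimately have hg: "h \<cdot> g = Ide C Q"
    using Q ks QO Comp_hom[OF g(1) h(1)] Ide_hom[OF QO] unfolding coproduct_def by blast
  have "iso_arr C h"
    using h(1) g(1) gh hg by (auto simp: iso_arr_def hom_def)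
  thus ?thesis using h by blast
qed

text \<open>Induction step that builds finite co-products from binary ones: an arrow out of
  \<open>Q\<close> is an arrow out of \<open>X\<close> together with an arrow out of
  \<open>P\<close>, and the latter is a family of arrows out of \<open>Xs\<close>.\<close>

lemma coproduct_Cons:
  assumes P: "coproduct C Xs P js" and Q: "coproduct C [X, P] Q [i, j]"
  shows "coproduct C (X # Xs) Q (i # map (\<lambda>k. j \<cdot> k) js)"
proof -
  have js: "list_all2 (\<lambda>X j. j \<in> hom C X P) Xs js" and i: "i \<in> hom C X Q" and j: "j \<in> hom C P Q"
    using P Q by (auto simp: coproduct_def)
  have js_hom: "\<exists>X. k \<in> hom C X P" if "k \<in> set js" for k
    using js that by (auto simp: list_all2_conv_all_nth in_set_conv_nth)
  have assoc: "map ((\<lambda>k. h \<cdot> k) \<circ> (\<lambda>k. j \<cdot> k)) js = map (\<lambda>k. (h \<cdot> j) \<cdot> k) js"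
    if "h \<in> hom C Q R" for h R
    using js_hom j that Comp_assoc by (fastforce)
  have "\<exists>!h. h \<in> hom C Q R \<and> map (\<lambda>k. h \<cdot> k) (i # map (\<lambda>k. j \<cdot> k) js) = ks"
    if R: "R \<in> Obj C" and ks: "list_all2 (\<lambda>X k. k \<in> hom C X R) (X # Xs) ks" for R ks
  proof -
    obtain l ls where kl: "ks = l # ls" "l \<in> hom C X R" "list_all2 (\<lambda>X k. k \<in> hom C X R) Xs ls"
      using ks by (auto simp: list_all2_Cons1)
    have e: "\<exists>!m. m \<in> hom C P R \<and> map (\<lambda>k. m \<cdot> k) js = ls"
      using P R kl(3) unfolding coproduct_def by blast
    then obtain m where m: "m \<in> hom C P R" "map (\<lambda>k. m \<cdot> k) js = ls" by blast
    have "list_all2 (\<lambda>X k. k \<in> hom C X R) [X, P] [l, m]" using kl(2) m(1) by simp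
    hence "\<exists>!h. h \<in> hom C Q R \<and> map (\<lambda>k. h \<cdot> k) [i, j] = [l, m]"
      by (rule Q[unfolded coproduct_def, THEN conjunct2, THEN conjunct2, THEN conjunct2, rule_format, OF R])
    \<comment> \<open>Since \<open>m\<close> is the only arrow out of \<open>P\<close> that
      restricts to \<open>ls\<close>, the condition on the whole family is the single equation
      \<open>h \<cdot> j = m\<close>.\<close>
    moreover have "h \<in> hom C Q R \<and> map (\<lambda>k. h \<cdot> k) (i # map (\<lambda>k. j \<cdot> k) js) = ks \<longleftrightarrow>
        h \<in> hom C Q R \<and> map (\<lambda>k. h \<cdot> k) [i, j] = [l, m]" for h
    proof -
      have "map (\<lambda>k. (h \<cdot> j) \<cdot> k) js = ls \<longleftrightarrow> h \<cdot> j = m" if "h \<in> hom C Q R"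
        using e m Comp_hom[OF j that] by metis
      thus ?thesis using assoc[of h R] kl(1) by auto
    qed
    ultimately show ?thesis by simp
  qed
  moreover have "list_all2 (\<lambda>X k. k \<in> hom C X Q) Xs (map (\<lambda>k. j \<cdot> k) js)"
    using js j Comp_hom by (auto simp: list_all2_conv_all_nth)
  ultimately show ?thesis
    using P Q i unfolding coproduct_def by simp
qed

end

section \<open>Initial sets and amalgamation sets as unique factorisation\<close>

lemma ex1D: "\<exists>!x. P x \<Longrightarrow> P a \<Longrightarrow> P b \<Longrightarrow> a = b"
  by auto

text \<open>Uniqueness of the object and uniqueness of the arrow merge into uniqueness of one pair.
  This form matches arrows out of a one-element family, which are pairs of an index and an arrow of
  \<open>A\<close>.\<close>

lemma initial_set_iff:
  "initial_set C S \<longleftrightarrow>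
     S \<subseteq> Obj C \<and> (\<forall>X \<in> Obj C. \<exists>!p. fst p \<in> S \<and> snd p \<in> hom C (fst p) X)"
proof -
  have "(\<exists>!I. I \<in> S \<and> hom C I X \<noteq> {}) \<and> (\<forall>I \<in> S. hom C I X \<noteq> {} \<longrightarrow> (\<exists>!f. f \<in> hom C I X))
     \<longleftrightarrow> (\<exists>!p. fst p \<in> S \<and> snd p \<in> hom C (fst p) X)" (is "?ex1 \<and> ?un \<longleftrightarrow> ?r") for X
  proof
    assume l: "?ex1 \<and> ?un"
    then have ex1: ?ex1 and un: ?un by (rule conjunct1, rule conjunct2)
    obtain I where I: "I \<in> S" "hom C I X \<noteq> {}"
      using ex1_implies_ex[OF ex1] by blast
    have ex1f: "\<exists>!f. f \<in> hom C I X" using un I by blast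
    then obtain f where f: "f \<in> hom C I X" by blast
    show ?r
    proof (rule ex1I[of _ "(I, f)"])
      fix p assume p: "fst p \<in> S \<and> snd p \<in> hom C (fst p) X"
      have I': "fst p = I"
        by (rule ex1D[OF ex1]) (use p I in auto)
      have "snd p = f"
        by (rule ex1D[OF ex1f]) (use p f I' in auto)
      with I' show "p = (I, f)" by (simp add: prod_eq_iff)
    qed (use I f in simp)
  next
    assume ?r
    then obtain p0 where p0: "fst p0 \<in> S" "snd p0 \<in> hom C (fst p0) X"
      using ex1_implies_ex by blast
    define I f where "I = fst p0" and "f = snd p0"
    have p: "I \<in> S" "f \<in> hom C I X" using p0 by (simp_all add: I_def f_def)
    have u': "J = I" "g = f" if "J \<in> S" "g \<in> hom C J X" for J g
    proof -
      have "(J, g) = (I, f)" by (rule ex1D[OF \<open>?r\<close>]) (use that p in simp_all)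
      thus "J = I" "g = f" by simp_all
    qed
    show "?ex1 \<and> ?un"
    proof
      show ?ex1 by (rule ex1I[of _ I]) (use p u'(1) in blast)+
      show ?un
      proof (intro ballI impI)
        fix J assume J: "J \<in> S" "hom C J X \<noteq> {}"
        hence "J = I" using u' by blast
        thus "\<exists>!g. g \<in> hom C J X" using p u'[of I] by blast
      qed
    qed
  qed
  thus ?thesis unfolding initial_set_def by simp
qed

text \<open>Carries unique existence along an injective encoding: from pairs to arrows of
  \<open>Amalg\<close>, to arrows out of one-element families, and to squares tagged by a pair of
  indices.\<close>

lemma ex1_image_iff:
  assumes "inj f"
  shows "(\<exists>!p. \<exists>q. p = f q \<and> Q q) \<longleftrightarrow> (\<exists>!q. Q q)"
proof
  assume l: "\<exists>!p. \<exists>q. p = f q \<and> Q q"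
  then obtain q where q: "Q q" by blast
  moreover have "r = q" if "Q r" for r
    using l q that injD[OF assms, of r q] by blast
  ultimately show "\<exists>!q. Q q" by blast
next
  assume "\<exists>!q. Q q"
  then obtain q where "Q q" "\<And>r. Q r \<Longrightarrow> r = q" by blast
  then show "\<exists>!p. \<exists>q. p = f q \<and> Q q" by blast
qed

text \<open>An object of \<open>Amalg C b c\<close> with its vertex as a parameter, so that the
  vertex need not be recovered as a codomain each time.\<close>

definition amalg_square :: "('o, 'm) cat \<Rightarrow> 'm \<Rightarrow> 'm \<Rightarrow> 'o \<Rightarrow> 'm \<Rightarrow> 'm \<Rightarrow> bool" where
  "amalg_square C b c D u v \<longleftrightarrow> D \<in> Obj C \<and> u \<in> hom C (Cod C b) D \<and> v \<in> hom C (Cod C c) D \<and>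
     u \<cdot>\<^bsub>C\<^esub> b = v \<cdot>\<^bsub>C\<^esub> c"

lemma Obj_Amalg: "Obj (Amalg C b c) = {(u, v). \<exists>D. amalg_square C b c D u v}"
  by (auto simp: Amalg_def Let_def amalg_square_def)

lemma hom_Amalg:
  "s \<in> Obj (Amalg C b c) \<Longrightarrow> t \<in> Obj (Amalg C b c) \<Longrightarrow>
   hom (Amalg C b c) s t =
     {(s, h, t) | h. h \<in> hom C (Cod C (fst s)) (Cod C (fst t)) \<and>
        h \<cdot>\<^bsub>C\<^esub> fst s = fst t \<and> h \<cdot>\<^bsub>C\<^esub> snd s = snd t}"
  by (cases s; cases t) (auto simp: Amalg_def Let_def hom_def)

text \<open>An arrow of \<open>Amalg C b c\<close> into a fixed square is determined by its source
  and its underlying arrow of \<open>C\<close>. Dropping the rest of the triple turns initiality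
  into unique factorisation through a member of \<open>S\<close>.\<close>

lemma amalgamation_set_iff:
  "amalgamation_set C b c S \<longleftrightarrow>
     (\<forall>(u, v) \<in> S. \<exists>D. amalg_square C b c D u v) \<and>
     (\<forall>D u v. amalg_square C b c D u v \<longrightarrow>
       (\<exists>!p. fst p \<in> S \<and> snd p \<in> hom C (Cod C (fst (fst p))) D \<and>
          snd p \<cdot>\<^bsub>C\<^esub> fst (fst p) = u \<and> snd p \<cdot>\<^bsub>C\<^esub> snd (fst p) = v))" (is "_ \<longleftrightarrow> ?sub \<and> ?ini")
proof -
  have sub: "?sub \<longleftrightarrow> S \<subseteq> Obj (Amalg C b c)" by (auto simp: Obj_Amalg)
  have main: "(\<exists>!p. fst p \<in> S \<and> snd p \<in> hom (Amalg C b c) (fst p) (u, v)) \<longleftrightarrow>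
        (\<exists>!p. fst p \<in> S \<and> snd p \<in> hom C (Cod C (fst (fst p))) D \<and>
          snd p \<cdot>\<^bsub>C\<^esub> fst (fst p) = u \<and> snd p \<cdot>\<^bsub>C\<^esub> snd (fst p) = v)" (is "(\<exists>!p. ?P p) \<longleftrightarrow> (\<exists>!p. ?Q p)")
    if S: "S \<subseteq> Obj (Amalg C b c)" and sq: "amalg_square C b c D u v" for D u v
  proof -
    have D: "Cod C u = D" using sq by (auto simp: amalg_square_def hom_def)
    have uv: "(u, v) \<in> Obj (Amalg C b c)" using sq by (auto simp: Obj_Amalg)
    have hm: "snd p \<in> hom (Amalg C b c) (fst p) (u, v) \<longleftrightarrow>
       (\<exists>h. snd p = (fst p, h, (u, v)) \<and> h \<in> hom C (Cod C (fst (fst p))) D \<and>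
          h \<cdot>\<^bsub>C\<^esub> fst (fst p) = u \<and> h \<cdot>\<^bsub>C\<^esub> snd (fst p) = v)" if "fst p \<in> S" for p
      using hom_Amalg[OF _ uv, of "fst p"] S that D by auto
    \<comment> \<open>The source occurs twice, once as the chosen member of \<open>S\<close> and
      once inside the triple; \<open>q\<close> can be read off, so the encoding is
      injective.\<close>
    have P: "?P p \<longleftrightarrow> (\<exists>q. p = (fst q, fst q, snd q, (u, v)) \<and> ?Q q)" for p
      using hm[of p] by (cases p) auto
    show ?thesis
      unfolding P by (rule ex1_image_iff) (auto simp: inj_on_def)
  qed
  have "(\<forall>t \<in> Obj (Amalg C b c). E t) \<longleftrightarrow> (\<forall>D u v. amalg_square C b c D u v \<longrightarrow> E (u, v))" for E
    by (auto simp: Obj_Amalg)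
  hence "(\<forall>t \<in> Obj (Amalg C b c). \<exists>!p. fst p \<in> S \<and> snd p \<in> hom (Amalg C b c) (fst p) t) \<longleftrightarrow> ?ini"
    if "S \<subseteq> Obj (Amalg C b c)"
    by (simp only: main[OF that] cong: imp_cong)
  thus ?thesis unfolding amalgamation_set_def initial_set_iff sub by (rule conj_cong[OF refl])
qed


section \<open>Arrows of \<open>\<bbbB>(A)\<close>\<close>

lemma hom_op_cat [simp]: "hom (op_cat A) X Y = hom A Y X"
  by (auto simp: hom_def op_cat_def)

lemma Comp_op_cat [simp]: "g \<cdot>\<^bsub>op_cat A\<^esub> f = f \<cdot>\<^bsub>A\<^esub> g"
  by (simp add: op_cat_def)

lemma Ide_op_cat [simp]: "Ide (op_cat A) = Ide A"
  by (simp add: op_cat_def)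

lemma BB_simps [simp]:
  "Obj (BB A) = {Xs. set Xs \<subseteq> Obj A}"
  "Dom (BB A) = fam_dom"
  "Cod (BB A) = fam_cod"
  "Ide (BB A) Xs = FamArr Xs Xs [0..<length Xs] (map (Ide A) Xs)"
  by (simp_all add: BB_def)

lemma Comp_BB_simps [simp]:
  "fam_dom (G \<cdot>\<^bsub>BB A\<^esub> F) = fam_dom F"
  "fam_cod (G \<cdot>\<^bsub>BB A\<^esub> F) = fam_cod G"
  "length (fam_idx (G \<cdot>\<^bsub>BB A\<^esub> F)) = length (fam_dom F)"
  "length (fam_mor (G \<cdot>\<^bsub>BB A\<^esub> F)) = length (fam_dom F)"
  "i < length (fam_dom F) \<Longrightarrow> fam_idx (G \<cdot>\<^bsub>BB A\<^esub> F) ! i = fam_idx G ! (fam_idx F ! i)"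
  "i < length (fam_dom F) \<Longrightarrow>
     fam_mor (G \<cdot>\<^bsub>BB A\<^esub> F) ! i = fam_mor F ! i \<cdot>\<^bsub>A\<^esub> fam_mor G ! (fam_idx F ! i)"
  by (simp_all add: BB_def)

lemma hom_BB_iff:
  "F \<in> hom (BB A) X Y \<longleftrightarrow>
     set X \<subseteq> Obj A \<and> set Y \<subseteq> Obj A \<and> fam_dom F = X \<and> fam_cod F = Y \<and>
     length (fam_idx F) = length X \<and> length (fam_mor F) = length X \<and>
     (\<forall>i < length X. fam_idx F ! i < length Y \<and> fam_mor F ! i \<in> hom A (Y ! (fam_idx F ! i)) (X ! i))"
proof -
  have "F \<in> Arr (BB A) \<longleftrightarrow> set (fam_dom F) \<subseteq> Obj A \<and> set (fam_cod F) \<subseteq> Obj A \<and>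
     length (fam_idx F) = length (fam_dom F) \<and> length (fam_mor F) = length (fam_dom F) \<and>
     (\<forall>i < length (fam_dom F). fam_idx F ! i < length (fam_cod F) \<and>
        fam_mor F ! i \<in> hom A (fam_cod F ! (fam_idx F ! i)) (fam_dom F ! i))"
    by (cases F) (simp add: BB_def)
  thus ?thesis unfolding hom_def[of "BB A"] by auto
qed

lemma Arr_BB_hom: "F \<in> Arr (BB A) \<longleftrightarrow> F \<in> hom (BB A) (fam_dom F) (fam_cod F)"
  by (simp add: hom_def)

lemma BB_eqI:
  assumes "F \<in> hom (BB A) X Y" "G \<in> hom (BB A) X Y"
    and "\<And>i. i < length X \<Longrightarrow> fam_idx F ! i = fam_idx G ! i \<and> fam_mor F ! i = fam_mor G ! i"
  shows "F = G"
proof (rule fam_arr.expand, intro conjI)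
  show "fam_idx F = fam_idx G" "fam_mor F = fam_mor G"
    by (rule nth_equalityI; use assms in \<open>simp add: hom_BB_iff\<close>)+
qed (use assms in \<open>simp_all add: hom_BB_iff\<close>)

text \<open>An arrow out of \<open>W\<close> is an independent choice, at each index, of a target
  index and a component, so unique choices assemble to a unique arrow. With \<open>R\<close> a
  condition that is checked index by index, this reduces the universal properties of co-products,
  final objects and fiber products to statements in \<open>A\<close>.\<close>

lemma ex1_hom_BB:
  assumes W: "set W \<subseteq> Obj A" and P: "set P \<subseteq> Obj A"
    and ex1: "\<And>i. i < length W \<Longrightarrow>
      \<exists>!p. fst p < length P \<and> snd p \<in> hom A (P ! fst p) (W ! i) \<and> R i (fst p) (snd p)"
  shows "\<exists>!h. h \<in> hom (BB A) W P \<and> (\<forall>i < length W. R i (fam_idx h ! i) (fam_mor h ! i))"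
proof -
  define Q where "Q i p \<longleftrightarrow> fst p < length P \<and> snd p \<in> hom A (P ! fst p) (W ! i) \<and> R i (fst p) (snd p)"
    for i p
  define c where "c i = (THE p. Q i p)" for i
  have c: "Q i (c i)" if "i < length W" for i
    unfolding c_def by (rule theI', unfold Q_def) (rule ex1[OF that])
  have cu: "p = c i" if "i < length W" "Q i p" for i p
    using ex1[OF that(1)] that(2) c[OF that(1)] unfolding Q_def by blast
  let ?h = "FamArr W P (map (fst \<circ> c) [0..<length W]) (map (snd \<circ> c) [0..<length W])"
  show ?thesis
  proof (rule ex1I[of _ ?h])
    show "?h \<in> hom (BB A) W P \<and> (\<forall>i < length W. R i (fam_idx ?h ! i) (fam_mor ?h ! i))"
      using c W P by (auto simp: hom_BB_iff Q_def)
    fix h assume h: "h \<in> hom (BB A) W P \<and> (\<forall>i < length W. R i (fam_idx h ! i) (fam_mor h ! i))"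
    have "(fam_idx h ! i, fam_mor h ! i) = c i" if "i < length W" for i
      by (rule cu[OF that]) (use h that in \<open>auto simp: Q_def hom_BB_iff\<close>)
    hence "fam_idx h ! i = fst (c i) \<and> fam_mor h ! i = snd (c i)" if "i < length W" for i
      using that by (metis fst_conv snd_conv)
    thus "h = ?h"
      using h c W P by (intro BB_eqI[of h A W P]) (auto simp: hom_BB_iff Q_def)
  qed
qed

section \<open>Arrows out of a one-element family\<close>

text \<open>The general form of an arrow out of an atom. As components live in the opposite
  category, \<open>m\<close> runs in \<open>A\<close> from \<open>Y ! k\<close> to
  \<open>x\<close>.\<close>

definition single_arr :: "'o \<Rightarrow> 'o list \<Rightarrow> nat \<Rightarrow> 'm \<Rightarrow> ('o, 'm) fam_arr" where
  "single_arr x Y k m = FamArr [x] Y [k] [m]"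

lemma single_arr_simps [simp]:
  "fam_dom (single_arr x Y k m) = [x]"
  "fam_cod (single_arr x Y k m) = Y"
  "fam_idx (single_arr x Y k m) = [k]"
  "fam_mor (single_arr x Y k m) = [m]"
  by (simp_all add: single_arr_def)

lemma single_arr_eq_iff [simp]:
  "single_arr x Y k m = single_arr x' Y' k' m' \<longleftrightarrow> x = x' \<and> Y = Y' \<and> k = k' \<and> m = m'"
  by (simp add: single_arr_def)

lemma Comp_single_arr [simp]:
  "G \<cdot>\<^bsub>BB A\<^esub> single_arr x Y k m =
     single_arr x (fam_cod G) (fam_idx G ! k) (m \<cdot>\<^bsub>A\<^esub> fam_mor G ! k)"
  by (simp add: single_arr_def BB_def)

lemma single_arr_hom_iff:
  "single_arr x Y k m \<in> hom (BB A) [x] Y \<longleftrightarrow>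
     x \<in> Obj A \<and> set Y \<subseteq> Obj A \<and> k < length Y \<and> m \<in> hom A (Y ! k) x"
  by (auto simp: hom_BB_iff)

lemma hom_BB_single:
  "hom (BB A) [x] Y =
     {single_arr x Y k m | k m. x \<in> Obj A \<and> set Y \<subseteq> Obj A \<and> k < length Y \<and> m \<in> hom A (Y ! k) x}"
proof -
  have "\<exists>k m. F = single_arr x Y k m" if "F \<in> hom (BB A) [x] Y" for F
    using that by (cases F) (auto simp: hom_BB_iff single_arr_def length_Suc_conv)
  thus ?thesis using single_arr_hom_iff by fastforce
qed

section \<open>The category axioms for \<open>BB C\<close>\<close>

context category
begin

lemma hom_Ide_nth: "set X \<subseteq> Obj C \<Longrightarrow> i < length X \<Longrightarrow> Ide C (X ! i) \<in> hom C (X ! i) (X ! i)"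
  by (meson Ide_hom nth_mem subsetD)

lemma Comp_BB_hom:
  assumes f: "f \<in> hom (BB C) X Y" and g: "g \<in> hom (BB C) Y Z"
  shows "g \<cdot>\<^bsub>BB C\<^esub> f \<in> hom (BB C) X Z"
proof -
  have "fam_mor f ! i \<cdot> fam_mor g ! (fam_idx f ! i)
      \<in> hom C (Z ! (fam_idx g ! (fam_idx f ! i))) (X ! i)" if "i < length X" for i
    by (rule Comp_hom[of _ _ "Y ! (fam_idx f ! i)"]) (use f g that in \<open>simp_all add: hom_BB_iff\<close>)
  thus ?thesis using f g by (simp add: hom_BB_iff)
qed

lemma Ide_BB_hom: "set X \<subseteq> Obj C \<Longrightarrow> Ide (BB C) X \<in> hom (BB C) X X"
  by (simp add: hom_BB_iff hom_Ide_nth)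

lemma category_BB: "category (BB C)"
proof
  fix f assume "f \<in> Arr (BB C)"
  thus "Dom (BB C) f \<in> Obj (BB C)" "Cod (BB C) f \<in> Obj (BB C)"
    by (simp_all add: Arr_BB_hom hom_BB_iff)
next
  fix X assume "X \<in> Obj (BB C)"
  thus "Ide (BB C) X \<in> hom (BB C) X X" using Ide_BB_hom by simp
next
  fix f g X Y Z assume "f \<in> hom (BB C) X Y" "g \<in> hom (BB C) Y Z"
  thus "g \<cdot>\<^bsub>BB C\<^esub> f \<in> hom (BB C) X Z" by (rule Comp_BB_hom)
next
  fix f X Y assume f: "f \<in> hom (BB C) X Y"
  hence XY: "set X \<subseteq> Obj C" "set Y \<subseteq> Obj C" by (simp_all add: hom_BB_iff)
  have m: "fam_mor f ! i \<in> hom C (Y ! (fam_idx f ! i)) (X ! i)" if "i < length X" for i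
    using f that by (simp add: hom_BB_iff)
  \<comment> \<open>Components compose in the opposite category, so each unit law rests on the
    opposite unit law of \<open>C\<close>.\<close>
  show "f \<cdot>\<^bsub>BB C\<^esub> Ide (BB C) X = f"
    by (rule BB_eqI[OF Comp_BB_hom[OF Ide_BB_hom[OF XY(1)] f] f])
      (use f m Ide_Comp in \<open>auto simp: hom_BB_iff\<close>)
  show "Ide (BB C) Y \<cdot>\<^bsub>BB C\<^esub> f = f"
    by (rule BB_eqI[OF Comp_BB_hom[OF f Ide_BB_hom[OF XY(2)]] f])
      (use f m Comp_Ide in \<open>auto simp: hom_BB_iff\<close>)
next
  fix f g h W X Y Z
  assume fgh: "f \<in> hom (BB C) W X" "g \<in> hom (BB C) X Y" "h \<in> hom (BB C) Y Z"
  show "(h \<cdot>\<^bsub>BB C\<^esub> g) \<cdot>\<^bsub>BB C\<^esub> f = h \<cdot>\<^bsub>BB C\<^esub> (g \<cdot>\<^bsub>BB C\<^esub> f)"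
  proof (rule BB_eqI)
    show "(h \<cdot>\<^bsub>BB C\<^esub> g) \<cdot>\<^bsub>BB C\<^esub> f \<in> hom (BB C) W Z" "h \<cdot>\<^bsub>BB C\<^esub> (g \<cdot>\<^bsub>BB C\<^esub> f) \<in> hom (BB C) W Z"
      by (rule Comp_BB_hom fgh)+
    fix i assume i: "i < length W"
    let ?k = "fam_idx f ! i" let ?l = "fam_idx g ! ?k"
    have "fam_mor f ! i \<in> hom C (X ! ?k) (W ! i)" "fam_mor g ! ?k \<in> hom C (Y ! ?l) (X ! ?k)"
      "fam_mor h ! ?l \<in> hom C (Z ! (fam_idx h ! ?l)) (Y ! ?l)"
      using fgh i by (simp_all add: hom_BB_iff)
    \<comment> \<open>For the same reason the component of \<open>h\<close> comes first here and
      that of \<open>f\<close> last.\<close>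
    from Comp_assoc[OF this(3) this(2) this(1)] show
      "fam_idx ((h \<cdot>\<^bsub>BB C\<^esub> g) \<cdot>\<^bsub>BB C\<^esub> f) ! i = fam_idx (h \<cdot>\<^bsub>BB C\<^esub> (g \<cdot>\<^bsub>BB C\<^esub> f)) ! i \<and>
       fam_mor ((h \<cdot>\<^bsub>BB C\<^esub> g) \<cdot>\<^bsub>BB C\<^esub> f) ! i = fam_mor (h \<cdot>\<^bsub>BB C\<^esub> (g \<cdot>\<^bsub>BB C\<^esub> f)) ! i"
      using fgh i by (simp add: hom_BB_iff)
  qed
qed

interpretation BB: category "BB C"
  by (rule category_BB)

lemma BB_eq_iff:
  "F \<in> hom (BB C) X Y \<Longrightarrow> G \<in> hom (BB C) X Y \<Longrightarrow>
   F = G \<longleftrightarrow> (\<forall>i < length X. fam_idx F ! i = fam_idx G ! i \<and> fam_mor F ! i = fam_mor G ! i)"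
  by (rule iffI) (simp, rule BB_eqI, auto)

end


section \<open>Co-products and atoms in \<open>\<bbbB>(A)\<close>\<close>

definition inl_BB :: "('o, 'm) cat \<Rightarrow> 'o list \<Rightarrow> 'o list \<Rightarrow> ('o, 'm) fam_arr" where
  "inl_BB A X Y = FamArr X (X @ Y) [0..<length X] (map (Ide A) X)"

definition inr_BB :: "('o, 'm) cat \<Rightarrow> 'o list \<Rightarrow> 'o list \<Rightarrow> ('o, 'm) fam_arr" where
  "inr_BB A X Y = FamArr Y (X @ Y) [length X..<length X + length Y] (map (Ide A) Y)"

context category
begin

interpretation BB: category "BB C"
  by (rule category_BB)

lemma inl_BB_hom: "set X \<subseteq> Obj C \<Longrightarrow> set Y \<subseteq> Obj C \<Longrightarrow> inl_BB C X Y \<in> hom (BB C) X (X @ Y)"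
  by (simp add: hom_BB_iff inl_BB_def nth_append hom_Ide_nth)

lemma inr_BB_hom: "set X \<subseteq> Obj C \<Longrightarrow> set Y \<subseteq> Obj C \<Longrightarrow> inr_BB C X Y \<in> hom (BB C) Y (X @ Y)"
  by (simp add: hom_BB_iff inr_BB_def nth_append hom_Ide_nth)

lemma Comp_inl_BB:
  assumes "h \<in> hom (BB C) (X @ Y) Q" "i < length X"
  shows "fam_idx (h \<cdot>\<^bsub>BB C\<^esub> inl_BB C X Y) ! i = fam_idx h ! i"
    and "fam_mor (h \<cdot>\<^bsub>BB C\<^esub> inl_BB C X Y) ! i = fam_mor h ! i"
proof -
  have "fam_mor h ! i \<in> hom C (Q ! (fam_idx h ! i)) ((X @ Y) ! i)"
    using assms by (simp add: hom_BB_iff)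
  thus "fam_mor (h \<cdot>\<^bsub>BB C\<^esub> inl_BB C X Y) ! i = fam_mor h ! i"
    using assms Ide_Comp by (simp add: inl_BB_def nth_append)
qed (use assms in \<open>simp add: inl_BB_def\<close>)

lemma Comp_inr_BB:
  assumes "h \<in> hom (BB C) (X @ Y) Q" "i < length Y"
  shows "fam_idx (h \<cdot>\<^bsub>BB C\<^esub> inr_BB C X Y) ! i = fam_idx h ! (length X + i)"
    and "fam_mor (h \<cdot>\<^bsub>BB C\<^esub> inr_BB C X Y) ! i = fam_mor h ! (length X + i)"
proof -
  have "fam_mor h ! (length X + i) \<in> hom C (Q ! (fam_idx h ! (length X + i))) ((X @ Y) ! (length X + i))"
    using assms unfolding hom_BB_iff length_append by (meson nat_add_left_cancel_less)
  thus "fam_mor (h \<cdot>\<^bsub>BB C\<^esub> inr_BB C X Y) ! i = fam_mor h ! (length X + i)"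
    using assms Ide_Comp by (simp add: inr_BB_def nth_append)
qed (use assms in \<open>simp add: inr_BB_def\<close>)

text \<open>An index of \<open>X @ Y\<close> is either an index of \<open>X\<close> or an index of
  \<open>Y\<close> shifted by \<open>length X\<close>, so an arrow out of \<open>X @ Y\<close>
  amounts to one arrow out of each part.\<close>

lemma coproduct_BB_append:
  assumes X: "set X \<subseteq> Obj C" and Y: "set Y \<subseteq> Obj C"
  shows "coproduct (BB C) [X, Y] (X @ Y) [inl_BB C X Y, inr_BB C X Y]"
proof -
  have ex1: "\<exists>!h. h \<in> hom (BB C) (X @ Y) Q \<and> h \<cdot>\<^bsub>BB C\<^esub> inl_BB C X Y = k \<and> h \<cdot>\<^bsub>BB C\<^esub> inr_BB C X Y = l"
    if Q: "set Q \<subseteq> Obj C" and k: "k \<in> hom (BB C) X Q" and l: "l \<in> hom (BB C) Y Q" for Q k l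
  proof -
    \<comment> \<open>Index and component of \<open>h\<close> at \<open>i\<close> are prescribed
      outright: they are the entries of the concatenated data of \<open>k\<close> and
      \<open>l\<close>.\<close>
    let ?R = "\<lambda>i n m. n = (fam_idx k @ fam_idx l) ! i \<and> m = (fam_mor k @ fam_mor l) ! i"
    have "\<exists>!h. h \<in> hom (BB C) (X @ Y) Q \<and>
        (\<forall>i < length (X @ Y). ?R i (fam_idx h ! i) (fam_mor h ! i))"
    proof (rule ex1_hom_BB)
      fix i assume i: "i < length (X @ Y)"
      let ?n = "(fam_idx k @ fam_idx l) ! i" and ?m = "(fam_mor k @ fam_mor l) ! i"
      have "?n < length Q \<and> ?m \<in> hom C (Q ! ?n) ((X @ Y) ! i)"
        using k l i by (auto simp: hom_BB_iff nth_append)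
      thus "\<exists>!p. fst p < length Q \<and> snd p \<in> hom C (Q ! fst p) ((X @ Y) ! i) \<and> ?R i (fst p) (snd p)"
        by (intro ex1I[of _ "(?n, ?m)"]) (auto simp: prod_eq_iff)
    qed (use X Y Q in auto)
    moreover have "h \<cdot>\<^bsub>BB C\<^esub> inl_BB C X Y = k \<and> h \<cdot>\<^bsub>BB C\<^esub> inr_BB C X Y = l \<longleftrightarrow>
        (\<forall>i < length (X @ Y). ?R i (fam_idx h ! i) (fam_mor h ! i))" if h: "h \<in> hom (BB C) (X @ Y) Q" for h
    proof -
      have "h \<cdot>\<^bsub>BB C\<^esub> inl_BB C X Y = k \<longleftrightarrow>
          (\<forall>i < length X. fam_idx h ! i = fam_idx k ! i \<and> fam_mor h ! i = fam_mor k ! i)"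
        using BB_eq_iff[OF BB.Comp_hom[OF inl_BB_hom[OF X Y] h] k] h by (simp add: Comp_inl_BB)
      moreover have "h \<cdot>\<^bsub>BB C\<^esub> inr_BB C X Y = l \<longleftrightarrow>
          (\<forall>i < length Y. fam_idx h ! (length X + i) = fam_idx l ! i \<and>
             fam_mor h ! (length X + i) = fam_mor l ! i)"
        using BB_eq_iff[OF BB.Comp_hom[OF inr_BB_hom[OF X Y] h] l] h by (simp add: Comp_inr_BB)
      moreover have "(\<forall>i < length (X @ Y). E i) \<longleftrightarrow>
          (\<forall>i < length X. E i) \<and> (\<forall>i < length Y. E (length X + i))" for E
        by (auto simp: all_conj_distrib) (metis add_diff_inverse_nat nat_add_left_cancel_less)
      ultimately show ?thesis using k l by (simp add: hom_BB_iff nth_append)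
    qed
    ultimately show ?thesis by (simp cong: conj_cong)
  qed
  have "\<exists>!h. h \<in> hom (BB C) (X @ Y) Q \<and> map (\<lambda>j. h \<cdot>\<^bsub>BB C\<^esub> j) [inl_BB C X Y, inr_BB C X Y] = ks"
    if Q: "set Q \<subseteq> Obj C" and ks: "list_all2 (\<lambda>X k. k \<in> hom (BB C) X Q) [X, Y] ks" for Q ks
  proof -
    obtain k l where kl: "ks = [k, l]" "k \<in> hom (BB C) X Q" "l \<in> hom (BB C) Y Q"
      using ks by (auto simp: list_all2_Cons1)
    show ?thesis using ex1[OF Q kl(2,3)] by (simp add: kl(1))
  qed
  thus ?thesis
    using X Y inl_BB_hom[OF X Y] inr_BB_hom[OF X Y] by (simp add: coproduct_def)
qed

lemma coproduct_BB_Nil: "coproduct (BB C) [] [] []"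
proof -
  have "\<exists>!h. h \<in> hom (BB C) [] Q" if "set Q \<subseteq> Obj C" for Q
    using that ex1_hom_BB[of "[]" C Q "\<lambda>_ _ _. True"] by simp
  thus ?thesis by (simp add: coproduct_def)
qed

lemma coproduct_BB_concat:
  "(\<And>X. X \<in> set Xs \<Longrightarrow> set X \<subseteq> Obj C) \<Longrightarrow> \<exists>js. coproduct (BB C) Xs (concat Xs) js"
proof (induction Xs)
  case Nil
  thus ?case using coproduct_BB_Nil by auto
next
  case (Cons X Xs)
  then obtain js where js: "coproduct (BB C) Xs (concat Xs) js" by auto
  have "set X \<subseteq> Obj C" "set (concat Xs) \<subseteq> Obj C" using Cons.prems by auto
  from BB.coproduct_Cons[OF js coproduct_BB_append[OF this]] show ?case by auto
qed

section \<open>Empty objects and atoms\<close>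

text \<open>A left inverse of an arrow is a left inverse on indices, which makes the index function
  injective. Hence length is an isomorphism invariant, and this detects empty objects and
  atoms.\<close>

lemma length_le_if_retract:
  assumes f: "f \<in> hom (BB C) X Y" and g: "g \<in> hom (BB C) Y X" and gf: "g \<cdot>\<^bsub>BB C\<^esub> f = Ide (BB C) X"
  shows "length X \<le> length Y"
proof -
  have "fam_idx g ! (fam_idx f ! i) = i" if "i < length X" for i
    using arg_cong[OF gf, of "\<lambda>h. fam_idx h ! i"] f that by (simp add: hom_BB_iff)
  hence "inj_on (\<lambda>i. fam_idx f ! i) {..<length X}" by (metis inj_onI lessThan_iff)
  moreover have "(\<lambda>i. fam_idx f ! i) ` {..<length X} \<subseteq> {..<length Y}"
    using f by (auto simp: hom_BB_iff)
  ultimately show ?thesis using card_inj_on_le[of _ "{..<length X}" "{..<length Y}"] by simp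
qed

lemma isomorphic_BB_length:
  assumes "isomorphic (BB C) X Y"
  shows "length X = length Y"
proof -
  obtain f g where "f \<in> hom (BB C) X Y" "g \<in> hom (BB C) Y X"
    "g \<cdot>\<^bsub>BB C\<^esub> f = Ide (BB C) X" "f \<cdot>\<^bsub>BB C\<^esub> g = Ide (BB C) Y"
    using assms by (auto simp: isomorphic_def iso_arr_def hom_def)
  thus ?thesis using length_le_if_retract by (meson le_antisym)
qed

text \<open>An initial object has an arrow to \<open>[]\<close>. Its index function maps into the
  empty set, so the initial object is itself \<open>[]\<close>.\<close>

lemma empty_obj_BB_iff: "empty_obj (BB C) X \<longleftrightarrow> X = []"
proof
  have ini: "initial_obj (BB C) []"
    using coproduct_BB_Nil by (simp add: coproduct_def initial_obj_def)
  show "empty_obj (BB C) X" if "X = []"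
    unfolding empty_obj_def that using ini BB.isomorphic_refl[of "[]"] by auto
  show "X = []" if X: "empty_obj (BB C) X"
  proof -
    obtain I where I: "initial_obj (BB C) I" "isomorphic (BB C) X I"
      using X unfolding empty_obj_def by blast
    have "\<exists>f. f \<in> hom (BB C) I []"
      using I(1) unfolding initial_obj_def by (intro ex1_implies_ex) simp
    hence "I = []" by (fastforce simp: hom_BB_iff)
    thus ?thesis using isomorphic_BB_length[OF I(2)] by simp
  qed
qed

text \<open>Splitting off the first member of an atom leaves an empty rest. Conversely, every
  co-product of \<open>Y\<close> and \<open>Z\<close> has the length of \<open>Y @ Z\<close>, and
  length one leaves room for only one non-empty summand.\<close>

lemma atom_BB_iff: "atom (BB C) X \<longleftrightarrow> (\<exists>x \<in> Obj C. X = [x])"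
proof
  assume a: "atom (BB C) X"
  hence X: "set X \<subseteq> Obj C" and "X \<noteq> []" by (simp_all add: atom_def empty_obj_BB_iff)
  then obtain x xs where x: "X = [x] @ xs" by (cases X) auto
  have "coproduct (BB C) [[x], xs] X [inl_BB C [x] xs, inr_BB C [x] xs]"
    using coproduct_BB_append[of "[x]" xs] X x by simp
  moreover have "isomorphic (BB C) X X" using X BB.isomorphic_refl by simp
  ultimately have "xs = []" using a unfolding atom_def empty_obj_BB_iff by blast
  thus "\<exists>x \<in> Obj C. X = [x]" using x X by simp
next
  assume "\<exists>x \<in> Obj C. X = [x]"
  then obtain x where x: "x \<in> Obj C" "X = [x]" by blast
  have "Y = [] \<or> Z = []" if P: "coproduct (BB C) [Y, Z] P js" and iso: "isomorphic (BB C) X P" for Y Z P js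
  proof -
    have "set Y \<subseteq> Obj C" "set Z \<subseteq> Obj C" using P by (simp_all add: coproduct_def)
    from BB.coproduct_unique[OF P coproduct_BB_append[OF this]]
    have "isomorphic (BB C) P (Y @ Z)" unfolding isomorphic_def by blast
    from isomorphic_BB_length[OF this] isomorphic_BB_length[OF iso]
    have "length (Y @ Z) = 1" using x(2) by simp
    thus ?thesis by (cases Y) auto
  qed
  thus "atom (BB C) X" using x unfolding atom_def empty_obj_BB_iff by auto
qed

section \<open>Maps from an atom into a co-product\<close>

text \<open>An arrow out of \<open>[x]\<close> hits a single index, which lies in exactly one of the
  two parts of \<open>Y @ Z\<close>.\<close>

lemma bij_hom_append:
  assumes x: "x \<in> Obj C" and Y: "set Y \<subseteq> Obj C" and Z: "set Z \<subseteq> Obj C"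
  shows "bij_betw (case_sum (\<lambda>f. inl_BB C Y Z \<cdot>\<^bsub>BB C\<^esub> f) (\<lambda>g. inr_BB C Y Z \<cdot>\<^bsub>BB C\<^esub> g))
    (hom (BB C) [x] Y <+> hom (BB C) [x] Z) (hom (BB C) [x] (Y @ Z))" (is "bij_betw ?F ?S ?T")
proof (rule bij_betwI')
  have inl: "inl_BB C Y Z \<cdot>\<^bsub>BB C\<^esub> single_arr x Y k m = single_arr x (Y @ Z) k m"
    if "k < length Y" "m \<in> hom C (Y ! k) x" for k m
    using that Comp_Ide by (simp add: inl_BB_def)
  have inr: "inr_BB C Y Z \<cdot>\<^bsub>BB C\<^esub> single_arr x Z k m = single_arr x (Y @ Z) (length Y + k) m"
    if "k < length Z" "m \<in> hom C (Z ! k) x" for k m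
    using that Comp_Ide by (simp add: inr_BB_def)
  show "?F s = ?F t \<longleftrightarrow> s = t" if "s \<in> ?S" "t \<in> ?S" for s t
    using that by (auto simp: hom_BB_single inl inr simp del: Comp_single_arr)
  show "?F s \<in> ?T" if "s \<in> ?S" for s
    using that BB.Comp_hom inl_BB_hom[OF Y Z] inr_BB_hom[OF Y Z] by auto
  show "\<exists>s \<in> ?S. h = ?F s" if h: "h \<in> ?T" for h
  proof -
    obtain k m where km: "h = single_arr x (Y @ Z) k m" "k < length (Y @ Z)" "m \<in> hom C ((Y @ Z) ! k) x"
      using h by (auto simp: hom_BB_single)
    show ?thesis
    proof (cases "k < length Y")
      case True
      hence m: "m \<in> hom C (Y ! k) x" using km by (simp add: nth_append)
      hence "Inl (single_arr x Y k m) \<in> ?S" using x Y True by (intro InlI) (simp add: single_arr_hom_iff)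
      thus ?thesis
        by (rule bexI[rotated]) (use inl[OF True m] km(1) in \<open>simp del: Comp_single_arr\<close>)
    next
      case False
      hence k: "k - length Y < length Z" and m: "m \<in> hom C (Z ! (k - length Y)) x"
        using km by (simp_all add: nth_append)
      hence "Inr (single_arr x Z (k - length Y) m) \<in> ?S" using x Z by (intro InrI) (simp add: single_arr_hom_iff)
      thus ?thesis
        by (rule bexI[rotated]) (use inr[OF k m] km(1) False in \<open>simp del: Comp_single_arr\<close>)
    qed
  qed
qed

text \<open>An isomorphism from \<open>Y @ Z\<close> to \<open>P\<close> that respects the
  injections transports the bijection for the concatenation to an arbitrary co-product.\<close>

lemma bij_hom_coproduct:
  assumes x: "x \<in> Obj C" and P: "coproduct (BB C) [Y, Z] P [i, j]"
  shows "bij_betw (case_sum (\<lambda>f. i \<cdot>\<^bsub>BB C\<^esub> f) (\<lambda>g. j \<cdot>\<^bsub>BB C\<^esub> g))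
    (hom (BB C) [x] Y <+> hom (BB C) [x] Z) (hom (BB C) [x] P)" (is "bij_betw ?G ?S _")
proof -
  have Y: "set Y \<subseteq> Obj C" and Z: "set Z \<subseteq> Obj C" using P by (simp_all add: coproduct_def)
  let ?F = "case_sum (\<lambda>f. inl_BB C Y Z \<cdot>\<^bsub>BB C\<^esub> f) (\<lambda>g. inr_BB C Y Z \<cdot>\<^bsub>BB C\<^esub> g)"
  obtain h where h: "h \<in> hom (BB C) (Y @ Z) P" "iso_arr (BB C) h"
    "h \<cdot>\<^bsub>BB C\<^esub> inl_BB C Y Z = i" "h \<cdot>\<^bsub>BB C\<^esub> inr_BB C Y Z = j"
    using BB.coproduct_unique[OF coproduct_BB_append[OF Y Z] P] by auto
  obtain g where g: "g \<in> hom (BB C) P (Y @ Z)"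
    "g \<cdot>\<^bsub>BB C\<^esub> h = Ide (BB C) (Y @ Z)" "h \<cdot>\<^bsub>BB C\<^esub> g = Ide (BB C) P"
    using h(1,2) unfolding iso_arr_def hom_def by auto
  have "bij_betw (\<lambda>f. h \<cdot>\<^bsub>BB C\<^esub> f) (hom (BB C) [x] (Y @ Z)) (hom (BB C) [x] P)"
  proof (rule bij_betw_byWitness[where f' = "\<lambda>f. g \<cdot>\<^bsub>BB C\<^esub> f"])
    show "\<forall>f \<in> hom (BB C) [x] (Y @ Z). g \<cdot>\<^bsub>BB C\<^esub> (h \<cdot>\<^bsub>BB C\<^esub> f) = f"
      using BB.Comp_assoc[OF _ h(1) g(1)] BB.Ide_Comp g(2) by metis
    show "\<forall>f \<in> hom (BB C) [x] P. h \<cdot>\<^bsub>BB C\<^esub> (g \<cdot>\<^bsub>BB C\<^esub> f) = f"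
      using BB.Comp_assoc[OF _ g(1) h(1)] BB.Ide_Comp g(3) by metis
  qed (use BB.Comp_hom h(1) g(1) in auto)
  from bij_betw_trans[OF bij_hom_append[OF x Y Z] this]
  have "bij_betw ((\<lambda>f. h \<cdot>\<^bsub>BB C\<^esub> f) \<circ> ?F) ?S (hom (BB C) [x] P)" .
  moreover have "((\<lambda>f. h \<cdot>\<^bsub>BB C\<^esub> f) \<circ> ?F) s = ?G s" if "s \<in> ?S" for s
  proof (cases s)
    case (Inl f)
    thus ?thesis using that BB.Comp_assoc[OF _ inl_BB_hom[OF Y Z] h(1), of f] h(3) by auto
  next
    case (Inr f)
    thus ?thesis using that BB.Comp_assoc[OF _ inr_BB_hom[OF Y Z] h(1), of f] h(4) by auto
  qed
  ultimately show ?thesis using bij_betw_cong[of ?S _ ?G] by blast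
qed

text \<open>The remaining clauses hold for every category \<open>C\<close>: finite co-products are
  concatenations, every family is the co-product of its one-element subfamilies, and Hom-sets out of
  atoms are covered by \<open>bij_hom_coproduct\<close>.\<close>

lemma B1_category_BB_iff:
  "B1_category (BB C) \<longleftrightarrow> has_fiber_products (BB C) \<and> (\<exists>T. final_obj (BB C) T)"
proof -
  have "has_finite_coproducts (BB C)"
    unfolding has_finite_coproducts_def
  proof (intro allI impI)
    fix Xs assume "set Xs \<subseteq> Obj (BB C)"
    then show "\<exists>P js. coproduct (BB C) Xs P js"
      using coproduct_BB_concat[of Xs] by (auto simp: subset_iff)
  qed
  moreover have "\<exists>Xs P js. (\<forall>Y \<in> set Xs. atom (BB C) Y) \<and> coproduct (BB C) Xs P js \<and> isomorphic (BB C) X P"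
    if "set X \<subseteq> Obj C" for X
  proof -
    have "\<exists>js. coproduct (BB C) (map (\<lambda>x. [x]) X) (concat (map (\<lambda>x. [x]) X)) js"
      by (rule coproduct_BB_concat) (use that in auto)
    then obtain js where "coproduct (BB C) (map (\<lambda>x. [x]) X) X js"
      by (auto simp: concat_map_singleton)
    moreover have "\<forall>Y \<in> set (map (\<lambda>x. [x]) X). atom (BB C) Y"
      using that by (auto simp: atom_BB_iff)
    moreover have "isomorphic (BB C) X X" using that BB.isomorphic_refl by simp
    ultimately show ?thesis by blast
  qed
  moreover have "\<forall>X Y Z P i j. atom (BB C) X \<and> coproduct (BB C) [Y, Z] P [i, j] \<longrightarrow>
      bij_betw (case_sum (\<lambda>f. i \<cdot>\<^bsub>BB C\<^esub> f) (\<lambda>g. j \<cdot>\<^bsub>BB C\<^esub> g))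
        (hom (BB C) X Y <+> hom (BB C) X Z) (hom (BB C) X P)"
    using bij_hom_coproduct by (auto simp: atom_BB_iff)
  ultimately show ?thesis
    unfolding B1_category_def using category_BB by simp
qed

end


section \<open>Final objects and fiber products in \<open>\<bbbB>(A)\<close>\<close>

text \<open>Every element of \<open>set T\<close> has an index, so uniqueness among indices passes
  to entries. This direction serves the families given by final objects and fiber products, where
  distinct entries are not assumed.\<close>

lemma ex1_set_if_ex1_nth:
  assumes "\<exists>!r. fst r < length T \<and> Q (T ! fst r) (snd r)"
  shows "\<exists>!p. fst p \<in> set T \<and> Q (fst p) (snd p)"
proof -
  obtain k m where k: "k < length T" "Q (T ! k) m" using assms by auto
  show ?thesis
  proof (rule ex1I[of _ "(T ! k, m)"])
    fix p assume p: "fst p \<in> set T \<and> Q (fst p) (snd p)"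
    then obtain l where l: "l < length T" "T ! l = fst p" by (auto simp: in_set_conv_nth)
    have "(l, snd p) = (k, m)" by (rule ex1D[OF assms]) (use p k l in simp_all)
    thus "p = (T ! k, m)" using l by (simp add: prod_eq_iff)
  qed (use k in simp)
qed

text \<open>With repetitions, one entry could sit at two indices and uniqueness of the index could
  fail. In a distinct list the entry determines its index.\<close>

lemma ex1_nth_iff:
  assumes "distinct T"
  shows "(\<exists>!r. fst r < length T \<and> Q (T ! fst r) (snd r)) \<longleftrightarrow>
    (\<exists>!p. fst p \<in> set T \<and> Q (fst p) (snd p))"
proof
  assume l: "\<exists>!r. fst r < length T \<and> Q (T ! fst r) (snd r)"
  then show "\<exists>!p. fst p \<in> set T \<and> Q (fst p) (snd p)" by (rule ex1_set_if_ex1_nth)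
next
  assume r: "\<exists>!p. fst p \<in> set T \<and> Q (fst p) (snd p)"
  then obtain t m where t: "t \<in> set T" "Q t m" by auto
  then obtain k where k: "k < length T" "T ! k = t" by (auto simp: in_set_conv_nth)
  show "\<exists>!r. fst r < length T \<and> Q (T ! fst r) (snd r)"
  proof (rule ex1I[of _ "(k, m)"])
    fix r assume q: "fst r < length T \<and> Q (T ! fst r) (snd r)"
    have "(T ! fst r, snd r) = (t, m)" by (rule ex1D[OF r]) (use q t in simp_all)
    thus "r = (k, m)"
      using q k nth_eq_iff_index_eq[OF assms, of "fst r" k] by (simp add: prod_eq_iff)
  qed (use k t in simp)
qed

context category
begin

interpretation BB: category "BB C"
  by (rule category_BB)

lemma ex1_hom_BB_single_iff:
  assumes "x \<in> Obj C" "set P \<subseteq> Obj C"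
  shows "(\<exists>!h. h \<in> hom (BB C) [x] P \<and> R h) \<longleftrightarrow>
    (\<exists>!r. fst r < length P \<and> snd r \<in> hom C (P ! fst r) x \<and> R (single_arr x P (fst r) (snd r)))"
proof -
  let ?S = "\<lambda>r. fst r < length P \<and> snd r \<in> hom C (P ! fst r) x \<and> R (single_arr x P (fst r) (snd r))"
  have "h \<in> hom (BB C) [x] P \<and> R h \<longleftrightarrow> (\<exists>r. h = single_arr x P (fst r) (snd r) \<and> ?S r)" for h
    using assms by (auto simp: hom_BB_single)
  moreover have "(\<exists>!h. \<exists>r. h = single_arr x P (fst r) (snd r) \<and> ?S r) \<longleftrightarrow> (\<exists>!r. ?S r)"
    by (rule ex1_image_iff) (auto simp: inj_on_def)
  ultimately show ?thesis by simp
qed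

section \<open>Final objects and initial sets\<close>

text \<open>Finality is tested on one-element families; by \<open>ex1_hom_BB\<close> the unique
  choices for the members of \<open>X\<close> give the unique arrow out of \<open>X\<close>.\<close>

lemma final_obj_BB_iff:
  "final_obj (BB C) T \<longleftrightarrow>
     set T \<subseteq> Obj C \<and> (\<forall>x \<in> Obj C. \<exists>!r. fst r < length T \<and> snd r \<in> hom C (T ! fst r) x)"
proof (intro iffI conjI ballI)
  assume T: "final_obj (BB C) T"
  thus TO: "set T \<subseteq> Obj C" by (simp add: final_obj_def)
  fix x assume x: "x \<in> Obj C"
  hence "\<exists>!f. f \<in> hom (BB C) [x] T" using T by (simp add: final_obj_def)
  thus "\<exists>!r. fst r < length T \<and> snd r \<in> hom C (T ! fst r) x"
    using ex1_hom_BB_single_iff[OF x TO, of "\<lambda>_. True"] by simp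
next
  assume r: "set T \<subseteq> Obj C \<and> (\<forall>x \<in> Obj C. \<exists>!r. fst r < length T \<and> snd r \<in> hom C (T ! fst r) x)"
  have "\<exists>!f. f \<in> hom (BB C) X T" if X: "set X \<subseteq> Obj C" for X
    using ex1_hom_BB[OF X, of T "\<lambda>_ _ _. True"] r X by (simp add: subset_iff)
  thus "final_obj (BB C) T" using r by (simp add: final_obj_def)
qed

text \<open>The members of a final family form an initial set, and a finite initial set listed
  without repetitions is a final family.\<close>

lemma ex_final_obj_BB_iff:
  "(\<exists>T. final_obj (BB C) T) \<longleftrightarrow> (\<exists>S. finite S \<and> initial_set C S)"
proof
  assume "\<exists>T. final_obj (BB C) T"
  then obtain T where T: "set T \<subseteq> Obj C"
    "\<And>x. x \<in> Obj C \<Longrightarrow> \<exists>!r. fst r < length T \<and> snd r \<in> hom C (T ! fst r) x"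
    by (auto simp: final_obj_BB_iff)
  have "initial_set C (set T)"
    unfolding initial_set_iff using T(1) ex1_set_if_ex1_nth[OF T(2)] by simp
  thus "\<exists>S. finite S \<and> initial_set C S" by blast
next
  assume "\<exists>S. finite S \<and> initial_set C S"
  then obtain T where T: "distinct T" "initial_set C (set T)"
    using finite_distinct_list by metis
  hence "final_obj (BB C) T"
    unfolding final_obj_BB_iff initial_set_iff
    by (simp add: ex1_nth_iff[OF T(1), of "\<lambda>t m. m \<in> hom C t _"])
  thus "\<exists>T. final_obj (BB C) T" ..
qed

text \<open>
  The universal property need only be tested on one-element families, where it becomes that of
  an amalgamation set.
\<close>

lemma fiber_product_BB_iff:
  assumes f: "f \<in> hom (BB C) X Z" and g: "g \<in> hom (BB C) Y Z"
    and p: "p \<in> hom (BB C) P X" and q: "q \<in> hom (BB C) P Y"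
    and pq: "f \<cdot>\<^bsub>BB C\<^esub> p = g \<cdot>\<^bsub>BB C\<^esub> q"
  shows "fiber_product (BB C) f g P p q \<longleftrightarrow>
    (\<forall>i < length X. \<forall>j < length Y. fam_idx f ! i = fam_idx g ! j \<longrightarrow>
      (\<forall>D u v. amalg_square C (fam_mor f ! i) (fam_mor g ! j) D u v \<longrightarrow>
        (\<exists>!r. fst r < length P \<and> snd r \<in> hom C (P ! fst r) D \<and>
          fam_idx p ! fst r = i \<and> snd r \<cdot> fam_mor p ! fst r = u \<and>
          fam_idx q ! fst r = j \<and> snd r \<cdot> fam_mor q ! fst r = v)))" (is "_ \<longleftrightarrow> ?pointwise")
proof -
  have objs: "set X \<subseteq> Obj C" "set Y \<subseteq> Obj C" "set Z \<subseteq> Obj C" "set P \<subseteq> Obj C"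
    and dom: "fam_dom f = X" "fam_cod f = Z" "fam_dom g = Y" "fam_cod g = Z"
    "fam_dom p = P" "fam_cod p = X" "fam_dom q = P" "fam_cod q = Y"
    using f g p q by (simp_all add: hom_BB_iff)
  have cod: "Cod C (fam_mor f ! i) = X ! i" if "i < length X" for i
    by (rule hom_Cod[of _ C "Z ! (fam_idx f ! i)"]) (use f that in \<open>simp add: hom_BB_iff\<close>)
  have cod': "Cod C (fam_mor g ! i) = Y ! i" if "i < length Y" for i
    by (rule hom_Cod[of _ C "Z ! (fam_idx g ! i)"]) (use g that in \<open>simp add: hom_BB_iff\<close>)
  have univ: "fiber_product (BB C) f g P p q \<longleftrightarrow>
     (\<forall>W. set W \<subseteq> Obj C \<longrightarrow> (\<forall>u \<in> hom (BB C) W X. \<forall>v \<in> hom (BB C) W Y.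
        f \<cdot>\<^bsub>BB C\<^esub> u = g \<cdot>\<^bsub>BB C\<^esub> v \<longrightarrow>
        (\<exists>!h. h \<in> hom (BB C) W P \<and> p \<cdot>\<^bsub>BB C\<^esub> h = u \<and> q \<cdot>\<^bsub>BB C\<^esub> h = v)))"
    using f g p q pq dom by (simp add: fiber_product_def Arr_BB_hom)
  show ?thesis
  proof
    assume fp: "fiber_product (BB C) f g P p q"
    show ?pointwise
    proof (intro allI impI)
      fix i j D u v
      assume ij: "i < length X" "j < length Y" "fam_idx f ! i = fam_idx g ! j"
        and sq: "amalg_square C (fam_mor f ! i) (fam_mor g ! j) D u v"
      have D: "D \<in> Obj C" and u: "u \<in> hom C (X ! i) D" and v: "v \<in> hom C (Y ! j) D"
        and uv: "u \<cdot> fam_mor f ! i = v \<cdot> fam_mor g ! j"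
        using sq cod[OF ij(1)] cod'[OF ij(2)] by (simp_all add: amalg_square_def)
      \<comment> \<open>A square with vertex \<open>D\<close> is a compatible pair of arrows from
        \<open>[D]\<close> to \<open>X\<close> and \<open>Y\<close>.\<close>
      have "\<exists>!h. h \<in> hom (BB C) [D] P \<and> p \<cdot>\<^bsub>BB C\<^esub> h = single_arr D X i u \<and>
          q \<cdot>\<^bsub>BB C\<^esub> h = single_arr D Y j v"
        by (rule fp[unfolded univ, rule_format, of "[D]"])
          (use objs D u v uv ij dom in \<open>simp_all add: single_arr_hom_iff\<close>)
      thus "\<exists>!r. fst r < length P \<and> snd r \<in> hom C (P ! fst r) D \<and>
          fam_idx p ! fst r = i \<and> snd r \<cdot> fam_mor p ! fst r = u \<and>
          fam_idx q ! fst r = j \<and> snd r \<cdot> fam_mor q ! fst r = v"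
        unfolding ex1_hom_BB_single_iff[OF D objs(4)] by (simp add: dom conj_assoc)
    qed
  next
    assume pw: ?pointwise
    show "fiber_product (BB C) f g P p q"
      unfolding univ
    proof (intro allI ballI impI)
      fix W u v
      assume W: "set W \<subseteq> Obj C" and u: "u \<in> hom (BB C) W X" and v: "v \<in> hom (BB C) W Y"
        and uv: "f \<cdot>\<^bsub>BB C\<^esub> u = g \<cdot>\<^bsub>BB C\<^esub> v"
      let ?R = "\<lambda>l k m. fam_idx p ! k = fam_idx u ! l \<and> m \<cdot> fam_mor p ! k = fam_mor u ! l \<and>
          fam_idx q ! k = fam_idx v ! l \<and> m \<cdot> fam_mor q ! k = fam_mor v ! l"
      have "\<exists>!h. h \<in> hom (BB C) W P \<and> (\<forall>l < length W. ?R l (fam_idx h ! l) (fam_mor h ! l))"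
      proof (rule ex1_hom_BB[OF W objs(4)])
        fix l assume l: "l < length W"
        have ij: "fam_idx u ! l < length X" "fam_idx v ! l < length Y"
          and hm: "fam_mor u ! l \<in> hom C (X ! (fam_idx u ! l)) (W ! l)"
            "fam_mor v ! l \<in> hom C (Y ! (fam_idx v ! l)) (W ! l)"
          and dm: "fam_dom u = W" "fam_dom v = W"
          using u v l by (simp_all add: hom_BB_iff)
        \<comment> \<open>Read at index \<open>l\<close>, the equation \<open>uv\<close> says that
          the two indices lie over the same index of \<open>Z\<close> and that the components of
          \<open>u\<close> and \<open>v\<close> form a square with vertex
          \<open>W ! l\<close>.\<close>
        have "fam_idx f ! (fam_idx u ! l) = fam_idx g ! (fam_idx v ! l)"
          using arg_cong[OF uv, of "\<lambda>h. fam_idx h ! l"] l dm by simp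
        moreover have "fam_mor u ! l \<cdot> fam_mor f ! (fam_idx u ! l) = fam_mor v ! l \<cdot> fam_mor g ! (fam_idx v ! l)"
          using arg_cong[OF uv, of "\<lambda>h. fam_mor h ! l"] l dm by simp
        ultimately show "\<exists>!r. fst r < length P \<and> snd r \<in> hom C (P ! fst r) (W ! l) \<and> ?R l (fst r) (snd r)"
          by (intro pw[rule_format] ij)
            (use hm ij W l in \<open>auto simp: amalg_square_def cod cod'\<close>)
      qed
      moreover have "p \<cdot>\<^bsub>BB C\<^esub> h = u \<and> q \<cdot>\<^bsub>BB C\<^esub> h = v \<longleftrightarrow>
          (\<forall>l < length W. ?R l (fam_idx h ! l) (fam_mor h ! l))" if h: "h \<in> hom (BB C) W P" for h
      proof -
        have "fam_dom h = W" using h by (simp add: hom_BB_iff)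
        thus ?thesis
          using BB_eq_iff[OF BB.Comp_hom[OF h p] u] BB_eq_iff[OF BB.Comp_hom[OF h q] v] by auto
      qed
      ultimately show "\<exists>!h. h \<in> hom (BB C) W P \<and> p \<cdot>\<^bsub>BB C\<^esub> h = u \<and> q \<cdot>\<^bsub>BB C\<^esub> h = v"
        by (simp cong: conj_cong)
    qed
  qed
qed

section \<open>Fiber products from amalgamation sets\<close>

text \<open>For each pair of indices with the same image in \<open>Z\<close>, an amalgamation set of
  the two components is chosen. The vertices of all these squares form the fiber product; the
  projections record the index pair and the two legs of the square.\<close>

lemma has_fiber_products_BB_if:
  assumes amalg: "\<And>b c. preamalgamation C b c \<Longrightarrow> \<exists>S. finite S \<and> amalgamation_set C b c S"
  shows "has_fiber_products (BB C)"
  unfolding has_fiber_products_def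
proof (intro ballI impI)
  fix f g assume "f \<in> Arr (BB C)" "g \<in> Arr (BB C)" "Cod (BB C) f = Cod (BB C) g"
  then obtain X Y Z where f: "f \<in> hom (BB C) X Z" and g: "g \<in> hom (BB C) Y Z"
    by (auto simp: hom_def)
  \<comment> \<open>The fiber product of the index sets.\<close>
  define I where "I = {(i, j). i < length X \<and> j < length Y \<and> fam_idx f ! i = fam_idx g ! j}"
  have "finite I" by (rule finite_subset[of _ "{..<length X} \<times> {..<length Y}"]) (auto simp: I_def)
  have f_hom: "fam_mor f ! i \<in> hom C (Z ! (fam_idx f ! i)) (X ! i)" if "i < length X" for i
    using f that by (simp add: hom_BB_iff)
  have g_hom: "fam_mor g ! i \<in> hom C (Z ! (fam_idx g ! i)) (Y ! i)" if "i < length Y" for i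
    using g that by (simp add: hom_BB_iff)
  have "preamalgamation C (fam_mor f ! i) (fam_mor g ! j)" if "(i, j) \<in> I" for i j
    using f_hom[of i] g_hom[of j] that by (simp add: I_def preamalgamation_def hom_def)
  note ex = amalg[OF this]
  define S where "S i j = (SOME S. finite S \<and> amalgamation_set C (fam_mor f ! i) (fam_mor g ! j) S)" for i j
  have S: "finite (S i j) \<and> amalgamation_set C (fam_mor f ! i) (fam_mor g ! j) (S i j)"
    if "(i, j) \<in> I" for i j
    unfolding S_def by (rule someI_ex[OF ex[OF that]])
  have "finite (SIGMA ij : I. S (fst ij) (snd ij))"
    using \<open>finite I\<close> S by (intro finite_SigmaI) auto
  \<comment> \<open>The tag keeps squares for different index pairs apart even if their legs
    coincide. Distinctness of \<open>L\<close> lets unique squares become unique indices.\<close>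
  then obtain L where L: "distinct L" "set L = (SIGMA ij : I. S (fst ij) (snd ij))"
    using finite_distinct_list by metis
  have L_sq: "\<exists>D. amalg_square C (fam_mor f ! i) (fam_mor g ! j) D u v" and L_I: "(i, j) \<in> I"
    if "((i, j), (u, v)) \<in> set L" for i j u v
    using that S[of i j] L(2) by (auto simp: amalgamation_set_iff)
  define P where "P = map (\<lambda>(ij, s). Cod C (fst s)) L"
  define p where "p = FamArr P X (map (\<lambda>(ij, s). fst ij) L) (map (\<lambda>(ij, s). fst s) L)"
  define q where "q = FamArr P Y (map (\<lambda>(ij, s). snd ij) L) (map (\<lambda>(ij, s). snd s) L)"
  have L_nth: "i < length X \<and> j < length Y \<and> fam_idx f ! i = fam_idx g ! j \<and>
      P ! k \<in> Obj C \<and> u \<in> hom C (X ! i) (P ! k) \<and> v \<in> hom C (Y ! j) (P ! k) \<and>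
      u \<cdot> fam_mor f ! i = v \<cdot> fam_mor g ! j"
    if k: "k < length L" and Lk: "L ! k = ((i, j), (u, v))" for k i j u v
  proof -
    have mem: "((i, j), (u, v)) \<in> set L" using k Lk by (metis nth_mem)
    have ij: "i < length X" "j < length Y" "fam_idx f ! i = fam_idx g ! j"
      using L_I[OF mem] by (simp_all add: I_def)
    obtain D where "amalg_square C (fam_mor f ! i) (fam_mor g ! j) D u v" using L_sq[OF mem] by blast
    hence D: "D \<in> Obj C" "u \<in> hom C (X ! i) D" "v \<in> hom C (Y ! j) D"
      "u \<cdot> fam_mor f ! i = v \<cdot> fam_mor g ! j"
      using f_hom[OF ij(1)] g_hom[OF ij(2)] by (simp_all add: amalg_square_def hom_def)
    moreover have "P ! k = D" using k Lk D(2) by (simp add: P_def hom_def)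
    ultimately show ?thesis using ij by simp
  qed
  have PO: "set P \<subseteq> Obj C"
  proof
    fix D assume "D \<in> set P"
    then obtain k where k: "k < length L" "P ! k = D" by (auto simp: P_def in_set_conv_nth)
    obtain i j u v where "L ! k = ((i, j), (u, v))" by (metis surj_pair)
    with L_nth[OF k(1)] k show "D \<in> Obj C" by simp
  qed
  have comps: "fam_idx p ! k < length X \<and> fam_mor p ! k \<in> hom C (X ! (fam_idx p ! k)) (P ! k) \<and>
      fam_idx q ! k < length Y \<and> fam_mor q ! k \<in> hom C (Y ! (fam_idx q ! k)) (P ! k) \<and>
      fam_idx f ! (fam_idx p ! k) = fam_idx g ! (fam_idx q ! k) \<and>
      fam_mor p ! k \<cdot> fam_mor f ! (fam_idx p ! k) = fam_mor q ! k \<cdot> fam_mor g ! (fam_idx q ! k)"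
    if k: "k < length P" for k
  proof -
    obtain i j u v where "L ! k = ((i, j), (u, v))" by (metis surj_pair)
    with L_nth[OF _ this] k show ?thesis by (simp add: p_def q_def P_def)
  qed
  have lens: "length P = length L" by (simp add: P_def)
  have p: "p \<in> hom (BB C) P X" and q: "q \<in> hom (BB C) P Y"
    using comps PO f g lens by (simp_all add: hom_BB_iff p_def q_def)
  have pq: "f \<cdot>\<^bsub>BB C\<^esub> p = g \<cdot>\<^bsub>BB C\<^esub> q"
    by (rule BB_eqI[OF BB.Comp_hom[OF p f] BB.Comp_hom[OF q g]])
      (use comps p q in \<open>simp add: hom_BB_iff\<close>)
  have "fiber_product (BB C) f g P p q"
    unfolding fiber_product_BB_iff[OF f g p q pq]
  proof (intro allI impI)
    fix i j D u v
    assume ij: "i < length X" "j < length Y" "fam_idx f ! i = fam_idx g ! j"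
      and sq: "amalg_square C (fam_mor f ! i) (fam_mor g ! j) D u v"
    have I: "(i, j) \<in> I" using ij by (simp add: I_def)
    \<comment> \<open>\<open>?Q\<close> is factorisation through a given square, and
      \<open>?Q'\<close> also asks for the tag \<open>(i, j)\<close>. Unique factorisation through
      \<open>S i j\<close> is moved first to the tagged squares in \<open>L\<close> and then to the
      indices of \<open>L\<close>.\<close>
    let ?Q = "\<lambda>s m. m \<in> hom C (Cod C (fst s)) D \<and> m \<cdot> fst s = u \<and> m \<cdot> snd s = v"
    let ?Q' = "\<lambda>t m. fst t = (i, j) \<and> ?Q (snd t) m"
    have "\<exists>!r. fst r \<in> S i j \<and> ?Q (fst r) (snd r)"
      using S[OF I] sq unfolding amalgamation_set_iff by blast
    hence "\<exists>!t. \<exists>r. t = (((i, j), fst r), snd r) \<and> fst r \<in> S i j \<and> ?Q (fst r) (snd r)"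
      by (subst ex1_image_iff) (auto simp: inj_on_def)
    moreover have "(\<exists>r. t = (((i, j), fst r), snd r) \<and> fst r \<in> S i j \<and> ?Q (fst r) (snd r)) \<longleftrightarrow>
        fst t \<in> set L \<and> ?Q' (fst t) (snd t)" for t
      using I unfolding L(2) by (cases t) auto
    ultimately have "\<exists>!t. fst t \<in> set L \<and> ?Q' (fst t) (snd t)" by simp
    hence "\<exists>!r. fst r < length L \<and> ?Q' (L ! fst r) (snd r)"
      by (simp only: ex1_nth_iff[OF L(1), of ?Q'])
    moreover have "fst r < length L \<and> ?Q' (L ! fst r) (snd r) \<longleftrightarrow>
        fst r < length P \<and> snd r \<in> hom C (P ! fst r) D \<and>
          fam_idx p ! fst r = i \<and> snd r \<cdot> fam_mor p ! fst r = u \<and>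
          fam_idx q ! fst r = j \<and> snd r \<cdot> fam_mor q ! fst r = v" for r
      by (cases "L ! fst r") (auto simp: p_def q_def P_def)
    ultimately show "\<exists>!r. fst r < length P \<and> snd r \<in> hom C (P ! fst r) D \<and>
          fam_idx p ! fst r = i \<and> snd r \<cdot> fam_mor p ! fst r = u \<and>
          fam_idx q ! fst r = j \<and> snd r \<cdot> fam_mor q ! fst r = v" by simp
  qed
  thus "\<exists>P p q. fiber_product (BB C) f g P p q" by blast
qed

section \<open>Amalgamation sets from fiber products of atoms\<close>

text \<open>Over one-element families every index into \<open>[x]\<close>, \<open>[y]\<close> or
  \<open>[z]\<close> is \<open>0\<close>, so the index conditions of
  \<open>fiber_product_BB_iff\<close> disappear. What is left is an amalgamation set, listed by the
  indices of \<open>P\<close>.\<close>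

lemma fiber_product_BB_single:
  assumes b: "b \<in> hom C z x" and c: "c \<in> hom C z y"
    and fp: "fiber_product (BB C) (single_arr x [z] 0 b) (single_arr y [z] 0 c) P p q"
  shows "k < length P \<Longrightarrow> amalg_square C b c (P ! k) (fam_mor p ! k) (fam_mor q ! k)"
    and "amalg_square C b c D u v \<Longrightarrow> \<exists>!r. fst r < length P \<and> snd r \<in> hom C (P ! fst r) D \<and>
      snd r \<cdot> fam_mor p ! fst r = u \<and> snd r \<cdot> fam_mor q ! fst r = v"
proof -
  let ?f = "single_arr x [z] 0 b" and ?g = "single_arr y [z] 0 c"
  have objs: "x \<in> Obj C" "y \<in> Obj C" "z \<in> Obj C"
    using b c Dom_closed Cod_closed by (auto simp: hom_def)
  have f: "?f \<in> hom (BB C) [x] [z]" and g: "?g \<in> hom (BB C) [y] [z]"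
    using b c objs by (simp_all add: single_arr_hom_iff)
  have p: "p \<in> hom (BB C) P [x]" and q: "q \<in> hom (BB C) P [y]"
    and pq: "?f \<cdot>\<^bsub>BB C\<^esub> p = ?g \<cdot>\<^bsub>BB C\<^esub> q"
    using fp by (simp_all add: fiber_product_def)
  have PO: "set P \<subseteq> Obj C" and dom: "fam_dom p = P" "fam_dom q = P"
    using p q by (simp_all add: hom_BB_iff)
  have comps: "fam_idx p ! k = 0 \<and> fam_mor p ! k \<in> hom C x (P ! k) \<and>
      fam_idx q ! k = 0 \<and> fam_mor q ! k \<in> hom C y (P ! k)" if "k < length P" for k
  proof -
    have "fam_idx p ! k = 0" "fam_idx q ! k = 0" using p q that by (simp_all add: hom_BB_iff)
    moreover have "fam_mor p ! k \<in> hom C ([x] ! (fam_idx p ! k)) (P ! k)"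
      "fam_mor q ! k \<in> hom C ([y] ! (fam_idx q ! k)) (P ! k)"
      using p q that unfolding hom_BB_iff by blast+
    ultimately show ?thesis by simp
  qed
  show "amalg_square C b c (P ! k) (fam_mor p ! k) (fam_mor q ! k)" if k: "k < length P"
  proof -
    have "fam_mor p ! k \<cdot> b = fam_mor q ! k \<cdot> c"
      using arg_cong[OF pq, of "\<lambda>h. fam_mor h ! k"] k comps[OF k] dom by simp
    moreover have "P ! k \<in> Obj C" using PO k by auto
    ultimately show ?thesis
      using comps[OF k] hom_Cod[OF b] hom_Cod[OF c] by (simp add: amalg_square_def)
  qed
  show "\<exists>!r. fst r < length P \<and> snd r \<in> hom C (P ! fst r) D \<and>
      snd r \<cdot> fam_mor p ! fst r = u \<and> snd r \<cdot> fam_mor q ! fst r = v"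
    if sq: "amalg_square C b c D u v"
  proof -
    have "\<exists>!r. fst r < length P \<and> snd r \<in> hom C (P ! fst r) D \<and>
          fam_idx p ! fst r = 0 \<and> snd r \<cdot> fam_mor p ! fst r = u \<and>
          fam_idx q ! fst r = 0 \<and> snd r \<cdot> fam_mor q ! fst r = v"
      by (rule fp[unfolded fiber_product_BB_iff[OF f g p q pq], rule_format]) (use sq in simp_all)
    moreover have "fst r < length P \<and> snd r \<in> hom C (P ! fst r) D \<and>
          fam_idx p ! fst r = 0 \<and> snd r \<cdot> fam_mor p ! fst r = u \<and>
          fam_idx q ! fst r = 0 \<and> snd r \<cdot> fam_mor q ! fst r = v \<longleftrightarrow>
        fst r < length P \<and> snd r \<in> hom C (P ! fst r) D \<and>
          snd r \<cdot> fam_mor p ! fst r = u \<and> snd r \<cdot> fam_mor q ! fst r = v" for r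
      using comps by auto
    ultimately show ?thesis by simp
  qed
qed

lemma ex_fiber_product_BB_single:
  assumes "has_fiber_products (BB C)" "b \<in> hom C z x" "c \<in> hom C z y"
  shows "\<exists>P p q. fiber_product (BB C) (single_arr x [z] 0 b) (single_arr y [z] 0 c) P p q"
proof -
  have "x \<in> Obj C" "y \<in> Obj C" "z \<in> Obj C"
    using assms(2,3) Dom_closed Cod_closed by (auto simp: hom_def)
  thus ?thesis
    using assms by (intro assms(1)[unfolded has_fiber_products_def, rule_format])
      (simp_all add: Arr_BB_hom single_arr_hom_iff)
qed

lemma amalgamation_set_if_fiber_products:
  assumes fps: "has_fiber_products (BB C)" and bc: "preamalgamation C b c"
  shows "\<exists>S. finite S \<and> amalgamation_set C b c S"
proof -
  have b: "b \<in> hom C (Dom C b) (Cod C b)" and c: "c \<in> hom C (Dom C b) (Cod C c)"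
    using bc by (simp_all add: preamalgamation_def hom_def)
  obtain P p q where fp:
    "fiber_product (BB C) (single_arr (Cod C b) [Dom C b] 0 b) (single_arr (Cod C c) [Dom C b] 0 c) P p q"
    using ex_fiber_product_BB_single[OF fps b c] by blast
  \<comment> \<open>The squares are the pairs of components of the two projections; the vertex
    \<open>P ! k\<close> returns as the codomain of the first leg.\<close>
  define T where "T = map (\<lambda>k. (fam_mor p ! k, fam_mor q ! k)) [0..<length P]"
  have cod: "Cod C (fam_mor p ! k) = P ! k" if "k < length P" for k
    using fiber_product_BB_single(1)[OF b c fp that] by (simp add: amalg_square_def hom_def)
  have "\<exists>!r. fst r \<in> set T \<and> snd r \<in> hom C (Cod C (fst (fst r))) D \<and>
      snd r \<cdot> fst (fst r) = u \<and> snd r \<cdot> snd (fst r) = v" if sq: "amalg_square C b c D u v" for D u v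
  proof -
    have "fst r < length P \<and> snd r \<in> hom C (P ! fst r) D \<and>
        snd r \<cdot> fam_mor p ! fst r = u \<and> snd r \<cdot> fam_mor q ! fst r = v \<longleftrightarrow>
      fst r < length T \<and> snd r \<in> hom C (Cod C (fst (T ! fst r))) D \<and>
        snd r \<cdot> fst (T ! fst r) = u \<and> snd r \<cdot> snd (T ! fst r) = v" for r
      using cod by (auto simp: T_def)
    with fiber_product_BB_single(2)[OF b c fp sq]
    have "\<exists>!r. fst r < length T \<and> snd r \<in> hom C (Cod C (fst (T ! fst r))) D \<and>
        snd r \<cdot> fst (T ! fst r) = u \<and> snd r \<cdot> snd (T ! fst r) = v" by simp
    thus ?thesis by (rule ex1_set_if_ex1_nth)
  qed
  moreover have "\<forall>(u, v) \<in> set T. \<exists>D. amalg_square C b c D u v"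
    using fiber_product_BB_single(1)[OF b c fp] by (fastforce simp: T_def)
  ultimately have "amalgamation_set C b c (set T)" by (simp add: amalgamation_set_iff)
  thus ?thesis by blast
qed

lemma B1_category_iff_A1_category: "B1_category (BB C) \<longleftrightarrow> A1_category C"
  unfolding B1_category_BB_iff A1_category_def ex_final_obj_BB_iff
  using has_fiber_products_BB_if amalgamation_set_if_fiber_products category_axioms by blast


section \<open>Monomorphisms of atoms and non-degeneracy\<close>

lemma hom_BB_single_single:
  "F \<in> hom (BB C) [x] [y] \<longleftrightarrow> (\<exists>f \<in> hom C y x. F = single_arr x [y] 0 f)"
  using Dom_closed Cod_closed by (auto simp: hom_BB_single) (auto simp: hom_def)

text \<open>Testing on \<open>[w]\<close> turns left cancellation of the one-element arrow into
  right cancellation of \<open>f\<close>. Conversely, arrows from any \<open>W\<close> to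
  \<open>[x]\<close> have all indices \<open>0\<close> and agree as soon as their components
  do.\<close>

lemma mono_arr_single_iff:
  assumes f: "f \<in> hom C y x"
  shows "mono_arr (BB C) (single_arr x [y] 0 f) \<longleftrightarrow> epi_arr C f"
proof -
  let ?F = "single_arr x [y] 0 f"
  have F: "?F \<in> hom (BB C) [x] [y]" using f hom_BB_single_single by blast
  have fh: "Dom C f = y" "Cod C f = x" "f \<in> Arr C" using f by (simp_all add: hom_def)
  have x: "x \<in> Obj C" using fh Cod_closed by blast
  show ?thesis
  proof
    assume m: "mono_arr (BB C) ?F"
    have "g = h" if w: "w \<in> Obj C" and g: "g \<in> hom C x w" and h: "h \<in> hom C x w" and gh: "g \<cdot> f = h \<cdot> f"
      for w g h
    proof -
      have "single_arr w [x] 0 g = single_arr w [x] 0 h"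
        using m unfolding mono_arr_def
        by (elim conjE, elim ballE[of _ _ "[w]"] ballE[of _ _ "single_arr w [x] 0 g"]
            ballE[of _ _ "single_arr w [x] 0 h"])
          (use w x g h gh in \<open>auto simp: single_arr_hom_iff\<close>)
      thus ?thesis by simp
    qed
    thus "epi_arr C f" using fh by (simp add: epi_arr_def)
  next
    assume e: "epi_arr C f"
    have "G = H" if G: "G \<in> hom (BB C) W [x]" and H: "H \<in> hom (BB C) W [x]"
      and GH: "?F \<cdot>\<^bsub>BB C\<^esub> G = ?F \<cdot>\<^bsub>BB C\<^esub> H" for W G H
    proof (rule BB_eqI[OF G H])
      fix i assume i: "i < length W"
      have idx: "fam_idx G ! i = 0" "fam_idx H ! i = 0" using G H i by (simp_all add: hom_BB_iff)
      have "fam_mor G ! i \<in> hom C ([x] ! (fam_idx G ! i)) (W ! i)"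
        "fam_mor H ! i \<in> hom C ([x] ! (fam_idx H ! i)) (W ! i)" "W ! i \<in> Obj C"
        using G H i unfolding hom_BB_iff by auto
      moreover have "fam_mor G ! i \<cdot> f = fam_mor H ! i \<cdot> f"
        using arg_cong[OF GH, of "\<lambda>F. fam_mor F ! i"] G H i idx by (simp add: hom_BB_iff)
      ultimately have "fam_mor G ! i = fam_mor H ! i"
        using e fh idx unfolding epi_arr_def by simp
      thus "fam_idx G ! i = fam_idx H ! i \<and> fam_mor G ! i = fam_mor H ! i" using idx by simp
    qed
    thus "mono_arr (BB C) ?F" using F by (simp add: mono_arr_def Arr_BB_hom)
  qed
qed

text \<open>Arrows between one-element families correspond to arrows of \<open>C\<close> in the
  reverse direction, identities to identities. The two inverse laws merely trade places.\<close>

lemma iso_arr_single_iff: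
  assumes f: "f \<in> hom C y x"
  shows "iso_arr (BB C) (single_arr x [y] 0 f) \<longleftrightarrow> iso_arr C f"
proof -
  have "single_arr x [y] 0 f \<in> hom (BB C) [x] [y]" using f hom_BB_single_single by blast
  moreover have "(\<exists>G \<in> hom (BB C) [y] [x]. R G) \<longleftrightarrow> (\<exists>g \<in> hom C x y. R (single_arr y [x] 0 g))" for R
    by (auto simp: hom_BB_single_single)
  moreover have "Ide (BB C) [z] = single_arr z [z] 0 (Ide C z)" for z
    by (simp add: single_arr_def)
  moreover have "f \<in> Arr C" "Dom C f = y" "Cod C f = x" using f by (simp_all add: hom_def)
  ultimately show ?thesis
    unfolding iso_arr_def by (auto simp: Arr_BB_hom simp del: BB_simps(4))
qed

lemma B_category_iff_A_category: "B_category (BB C) \<longleftrightarrow> A_category C"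
proof -
  have "(\<forall>F. mono_arr (BB C) F \<and> atom (BB C) (fam_dom F) \<and> atom (BB C) (fam_cod F) \<longrightarrow> iso_arr (BB C) F)
    \<longleftrightarrow> (\<forall>f. epi_arr C f \<longrightarrow> iso_arr C f)" (is "?mono \<longleftrightarrow> ?epi")
  proof
    assume m: ?mono
    show ?epi
    proof (intro allI impI)
      fix f assume e: "epi_arr C f"
      hence f: "f \<in> hom C (Dom C f) (Cod C f)" by (simp add: epi_arr_def hom_def)
      have "Dom C f \<in> Obj C" "Cod C f \<in> Obj C"
        using e Dom_closed Cod_closed by (simp_all add: epi_arr_def)
      hence "iso_arr (BB C) (single_arr (Cod C f) [Dom C f] 0 f)"
        using m e mono_arr_single_iff[OF f] by (simp add: atom_BB_iff)
      thus "iso_arr C f" using iso_arr_single_iff[OF f] by simp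
    qed
  next
    assume e: ?epi
    show ?mono
    proof (intro allI impI, elim conjE)
      fix F assume F: "mono_arr (BB C) F" "atom (BB C) (fam_dom F)" "atom (BB C) (fam_cod F)"
      then obtain x y where "fam_dom F = [x]" "fam_cod F = [y]" by (auto simp: atom_BB_iff)
      hence "F \<in> hom (BB C) [x] [y]" using F(1) by (simp add: mono_arr_def Arr_BB_hom)
      then obtain f where f: "f \<in> hom C y x" "F = single_arr x [y] 0 f"
        using hom_BB_single_single by blast
      thus "iso_arr (BB C) F"
        using F(1) e mono_arr_single_iff[OF f(1)] iso_arr_single_iff[OF f(1)] by simp
    qed
  qed
  thus ?thesis by (simp add: B_category_def A_category_def B1_category_iff_A1_category)
qed

section \<open>Non-degeneracy\<close>

text \<open>With \<open>0\<close> as the only index, unique existence of an index with an arrow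
  becomes unique existence of an arrow out of the single member \<open>t\<close>.\<close>

lemma initial_obj_if_final_atom:
  assumes "final_obj (BB C) T" "atom (BB C) T"
  shows "\<exists>I. initial_obj C I"
proof -
  obtain t where t: "t \<in> Obj C" "T = [t]" using assms(2) by (auto simp: atom_BB_iff)
  have "\<exists>!f. f \<in> hom C t x" if x: "x \<in> Obj C" for x
  proof -
    have ex1: "\<exists>!r. fst r < length T \<and> snd r \<in> hom C (T ! fst r) x"
      using assms(1) x by (simp add: final_obj_BB_iff)
    obtain f where f: "f \<in> hom C t x" using ex1_implies_ex[OF ex1] t(2) by auto
    have "g = f" if "g \<in> hom C t x" for g
    proof -
      have "(0::nat, g) = (0, f)" by (rule ex1D[OF ex1]) (use that f t(2) in simp_all)
      thus ?thesis by simp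
    qed
    thus ?thesis using f by blast
  qed
  hence "initial_obj C t" using t by (simp add: initial_obj_def)
  thus ?thesis ..
qed

text \<open>Some member \<open>T ! k\<close> maps to \<open>I\<close> and hence, through
  \<open>I\<close>, to every member of \<open>T\<close>. Each member also receives its own identity,
  so uniqueness leaves \<open>k\<close> as the only index.\<close>

lemma final_obj_BB_atom:
  assumes I: "initial_obj C I" and T: "final_obj (BB C) T"
  shows "atom (BB C) T"
proof -
  have TO: "set T \<subseteq> Obj C"
    and ex1: "\<And>x. x \<in> Obj C \<Longrightarrow> \<exists>!r. fst r < length T \<and> snd r \<in> hom C (T ! fst r) x"
    using T by (simp_all add: final_obj_BB_iff)
  have "I \<in> Obj C" using I by (simp add: initial_obj_def)
  then obtain k m where k: "k < length T" "m \<in> hom C (T ! k) I"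
    using ex1_implies_ex[OF ex1] by blast
  have "l = k" if l: "l < length T" for l
  proof -
    have O: "T ! l \<in> Obj C" using l TO by auto
    have "\<exists>!n. n \<in> hom C I (T ! l)" using I O by (simp add: initial_obj_def)
    then obtain n where "n \<in> hom C I (T ! l)" by blast
    hence "n \<cdot> m \<in> hom C (T ! k) (T ! l)" using Comp_hom k(2) by blast
    moreover have "Ide C (T ! l) \<in> hom C (T ! l) (T ! l)" by (rule Ide_hom[OF O])
    ultimately have "(l, Ide C (T ! l)) = (k, n \<cdot> m)"
      by (intro ex1D[OF ex1[OF O]]) (use k l in simp_all)
    thus ?thesis by simp
  qed
  hence "length T = 1"
    using k(1) by (metis One_nat_def less_one linorder_neqE_nat not_less_zero length_0_conv gr0I Suc_lessI)
  thus ?thesis using TO by (auto simp: atom_BB_iff length_Suc_conv)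
qed

text \<open>The two clauses correspond separately: atomic final objects to an initial object, and
  non-empty fiber products of atoms to amalgamation. As \<open>nondegenerate\<close> only speaks
  about all final objects and fiber products, the hypothesis supplies the ones to which it is
  applied.\<close>

lemma nondegenerate_BB_iff:
  assumes "B1_category (BB C)"
  shows "nondegenerate (BB C) \<longleftrightarrow> (\<exists>I. initial_obj C I) \<and> amalgamation_property C"
proof
  have fps: "has_fiber_products (BB C)" using assms by (simp add: B1_category_BB_iff)
  assume nd: "nondegenerate (BB C)"
  obtain T where "final_obj (BB C) T" using assms by (auto simp: B1_category_BB_iff)
  hence "\<exists>I. initial_obj C I" using nd initial_obj_if_final_atom by (simp add: nondegenerate_def)
  moreover have "Obj (Amalg C b c) \<noteq> {}" if bc: "preamalgamation C b c" for b c
  proof -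
    have b: "b \<in> hom C (Dom C b) (Cod C b)" and c: "c \<in> hom C (Dom C b) (Cod C c)"
      using bc by (simp_all add: preamalgamation_def hom_def)
    have objs: "Dom C b \<in> Obj C" "Cod C b \<in> Obj C" "Cod C c \<in> Obj C"
      using bc Dom_closed Cod_closed by (simp_all add: preamalgamation_def)
    obtain P p q where fp:
      "fiber_product (BB C) (single_arr (Cod C b) [Dom C b] 0 b) (single_arr (Cod C c) [Dom C b] 0 c) P p q"
      using ex_fiber_product_BB_single[OF fps b c] by blast
    have "\<not> empty_obj (BB C) P"
      by (rule nd[unfolded nondegenerate_def, THEN conjunct2, rule_format, OF conjI[OF _ conjI[OF _ conjI[OF _ fp]]]])
        (use objs in \<open>simp_all add: atom_BB_iff\<close>)
    \<comment> \<open>Index \<open>0\<close> of the non-empty family \<open>P\<close> yields a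
      square.\<close>
    hence "0 < length P" by (simp add: empty_obj_BB_iff)
    from fiber_product_BB_single(1)[OF b c fp this] show ?thesis by (auto simp: Obj_Amalg)
  qed
  ultimately show "(\<exists>I. initial_obj C I) \<and> amalgamation_property C"
    by (simp add: amalgamation_property_def)
next
  assume a: "(\<exists>I. initial_obj C I) \<and> amalgamation_property C"
  have "\<not> empty_obj (BB C) P"
    if at: "atom (BB C) (fam_dom f)" "atom (BB C) (fam_dom g)" "atom (BB C) (fam_cod f)"
      and fp: "fiber_product (BB C) f g P p q" for f g P p q
  proof -
    obtain x y z where "fam_dom f = [x]" "fam_dom g = [y]" "fam_cod f = [z]"
      using at by (auto simp: atom_BB_iff)
    hence "f \<in> hom (BB C) [x] [z]" "g \<in> hom (BB C) [y] [z]"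
      using fp by (auto simp: fiber_product_def Arr_BB_hom)
    then obtain b c where b: "b \<in> hom C z x" "f = single_arr x [z] 0 b"
      and c: "c \<in> hom C z y" "g = single_arr y [z] 0 c"
      using hom_BB_single_single by blast
    have "preamalgamation C b c" using b(1) c(1) by (simp add: preamalgamation_def hom_def)
    then obtain D u v where "amalg_square C b c D u v"
      using a by (fastforce simp: amalgamation_property_def Obj_Amalg)
    \<comment> \<open>Conversely, a square factors through the square at some index of
      \<open>P\<close>, so \<open>P\<close> has an index.\<close>
    from ex1_implies_ex[OF fiber_product_BB_single(2)[OF b(1) c(1) fp[unfolded b(2) c(2)] this]]
    have "P \<noteq> []" by auto
    thus ?thesis by (simp add: empty_obj_BB_iff)
  qed
  thus "nondegenerate (BB C)"
    using a final_obj_BB_atom by (auto simp: nondegenerate_def)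
qed

end

theorem theorem5p8:
  fixes A :: "('o, 'm) cat"
  assumes "category A"
  shows "(B1_category (BB A) \<longleftrightarrow> A1_category A) \<and>
         (B_category (BB A) \<longleftrightarrow> A_category A) \<and>
         (B_category (BB A) \<and> nondegenerate (BB A) \<longleftrightarrow>
            A_category A \<and> (\<exists>I. initial_obj A I) \<and> amalgamation_property A)"
proof -
  interpret category A by fact
  \<comment> \<open>In the third equivalence, the hypothesis of \<open>nondegenerate_BB_iff\<close>
    comes from the first one, since an \<open>A_category\<close> is in particular an
    \<open>A1_category\<close>.\<close>
  show ?thesis
    using B1_category_iff_A1_category B_category_iff_A_category nondegenerate_BB_iff
    by (auto simp: A_category_def)
qed

end
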